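(* Let $(r_{h1},r_{h2})$ be an arbitrary pair of vertices in $\mathcal{O}_h$ $(h=1,2,\dots,t)$, where $\mathcal{O}_1,\dots,\mathcal{O}_t$ are the orbitals of edges and nonedges of $G$. Then the semidefinite program $\mathrm{MC}^h_{\mathrm{GPP}}$ is equivalent to $\mathrm{MC}^h_{\mathrm{QAP}}$ in the sense that there is a bijection between the feasible sets that preserves the objective function.
   Context: Setting: $G$ is an undirected graph on vertex set $\{1,\dots,n\}$ with adjacency matrix $A$; $m=(m_1,m_2,m_3)$ consists of nonnegative integers with $m_1,m_2\ge1$ and $m_1+m_2+m_3=n$. The orbitals of edges and nonedges are the orbits of the automorphism group of $G$ acting on ordered pairs of distinct vertices. The cut graph $G_{m_1,m_2,m_3}$ is the graph on $\{1,\dots,n\}$ with adjacency matrix $$B=\begin{pmatrix} 0_{m_1\times m_1} & J_{m_1\times m_2} & 0_{m_1\times m_3}\\ J_{m_2\times m_1} & 0_{m_2\times m_2} & 0_{m_2\times m_3}\\ 0_{m_3\times m_1} & 0_{m_3\times m_2} & 0_{m_3\times m_3}\end{pmatrix},$$ where $J_{p\times q}$ is the $p\times q$ all-ones matrix. $(s_1,s_2)$ is an arbitrary edge of the cut graph, with the convention $s_1\in\{1,\dots,m_1\}$ and $s_2\in\{m_1+1,\dots,m_1+m_2\}$. Notation: $\mathcal{S}^+_k$ is the set of $k\times k$ real symmetric positive semidefinite matrices; $I_k,J_k,u_k$ are the identity matrix, all-ones matrix and all-ones vector of order $k$; $E_{ij}=e_ie_j^{\mathrm T}$ with $e_i$ the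 standard basis vectors; $\otimes$ is the Kronecker product; $Y\ge0$ is meant entrywise. $\mathrm{MC}^h_{\mathrm{QAP}}$: minimize $\frac12\operatorname{tr}\big((B\otimes A)Y\big)$ over $Y\in\mathcal{S}^+_{n^2}$, $Y\ge0$, subject to - $\operatorname{tr}\big((I_n\otimes E_{jj})Y\big)=1$, $\operatorname{tr}\big((E_{jj}\otimes I_n)Y\big)=1$ for $j=1,\dots,n$; - $\operatorname{tr}\big((I_n\otimes(J_n-I_n)+(J_n-I_n)\otimes I_n)Y\big)=0$; - $\operatorname{tr}(J_{n^2}Y)=n^2$; - $\operatorname{tr}\big((E_{s_is_i}\otimes E_{r_{hi}r_{hi}})Y\big)=1$ for $i=1,2$ (all $E$ matrices of order $n$). $\mathrm{MC}^h_{\mathrm{GPP}}$: minimize $\frac12\operatorname{tr}\big((D\otimes A)Y\big)$ over pairs $(Y,y)$ with $Y$ a symmetric $3n\times3n$ matrix and $y\in\mathbb{R}^{3n}$, subject to - $\operatorname{tr}\big(((J_3-I_3)\otimes I_n)Y\big)=0$; - $\operatorname{tr}\big((I_3\otimes J_n)Y\big)+\operatorname{tr}(Y)=-\big(\sum_{i=1}^3m_i^2+n\big)+2y^{\mathrm T}\big((m+u_3)\otimes u_n\big)$; - $\operatorname{tr}\big((\bar E_{ii}\otimes E_{r_{hi}r_{hi}})Y\big)=1$ for $i=1,2$, where $\bar E_{ii}=e_ie_i^{\mathrm T}\in\mathbb{R}^{3\times3}$ and $E_{r_{hi}r_{hi}}\in\mathbb{R}^{n\times n}$; - $\begin{pmatrix}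 1 & y^{\mathrm T} \\ y & Y \end{pmatrix}\in\mathcal{S}^+_{3n+1}$, $Y\ge0$; where $D=E_{12}+E_{21}\in\mathbb{R}^{3\times3}$.
   Formalization: A bijection of the full feasible sets fails (n=4, m=(1,3,0)); proved instead from the MC_QAP points invariant under cut-graph automorphisms fixing s_1, s_2 onto all of MC_GPP; the map preserves the objective on every MC_QAP point and gives it the same image as its group average. *)

theory Defs
  imports "Jordan_Normal_Form.Matrix" "HOL-Combinatorics.Permutations"
begin

text \<open>
  All index sets are zero-based: vertices are \<open>0, \<dots>, n - 1\<close>, the three parts of the cut graph
  are \<open>{0..<m1}\<close>, \<open>{m1..<m1 + m2}\<close>, \<open>{m1 + m2..<m1 + m2 + m3}\<close>, and the three block
  indices of a \<open>3n \<times> 3n\<close> matrix are \<open>0, 1, 2\<close>.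
\<close>

definition simple_graph :: "nat \<Rightarrow> (nat \<Rightarrow> nat \<Rightarrow> bool) \<Rightarrow> bool" where
  "simple_graph n E \<longleftrightarrow>
     (\<forall>i<n. \<not> E i i) \<and> (\<forall>i<n. \<forall>j<n. E i j \<longleftrightarrow> E j i)"

definition adj_mat :: "nat \<Rightarrow> (nat \<Rightarrow> nat \<Rightarrow> bool) \<Rightarrow> real mat" where
  "adj_mat n E = mat n n (\<lambda>(i, j). if E i j then 1 else 0)"

definition automorphisms :: "nat \<Rightarrow> (nat \<Rightarrow> nat \<Rightarrow> bool) \<Rightarrow> (nat \<Rightarrow> nat) set" where
  "automorphisms n E =
     {\<pi>. \<pi> permutes {..<n} \<and> (\<forall>i<n. \<forall>j<n. E (\<pi> i) (\<pi> j) \<longleftrightarrow> E i j)}"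

definition orbitals :: "nat \<Rightarrow> (nat \<Rightarrow> nat \<Rightarrow> bool) \<Rightarrow> (nat \<times> nat) set set" where
  "orbitals n E =
     {{(\<pi> a, \<pi> b) | \<pi>. \<pi> \<in> automorphisms n E} | a b. a < n \<and> b < n \<and> a \<noteq> b}"

definition kron :: "real mat \<Rightarrow> real mat \<Rightarrow> real mat" (infixl \<open>\<otimes>\<^sub>m\<close> 70) where
  "A \<otimes>\<^sub>m B = mat (dim_row A * dim_row B) (dim_col A * dim_col B)
     (\<lambda>(i, j). A $$ (i div dim_row B, j div dim_col B) * B $$ (i mod dim_row B, j mod dim_col B))"

definition kron_vec :: "real vec \<Rightarrow> real vec \<Rightarrow> real vec" (infixl \<open>\<otimes>\<^sub>v\<close> 70) where
  "x \<otimes>\<^sub>v y = vec (dim_vec x * dim_vec y)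
     (\<lambda>i. x $ (i div dim_vec y) * y $ (i mod dim_vec y))"

definition tr :: "real mat \<Rightarrow> real" where
  "tr A = (\<Sum>i<dim_row A. A $$ (i, i))"

definition ones_mat :: "nat \<Rightarrow> nat \<Rightarrow> real mat" where
  "ones_mat p q = mat p q (\<lambda>_. 1)"

definition ones_vec :: "nat \<Rightarrow> real vec" where
  "ones_vec k = vec k (\<lambda>_. 1)"

definition E_mat :: "nat \<Rightarrow> nat \<Rightarrow> nat \<Rightarrow> real mat" where
  "E_mat k i j = mat k k (\<lambda>(p, q). if p = i \<and> q = j then 1 else 0)"

definition psd_mats :: "nat \<Rightarrow> real mat set" where
  "psd_mats k = {A \<in> carrier_mat k k. transpose_mat A = A \<and>
     (\<forall>x \<in> carrier_vec k. x \<bullet> (A *\<^sub>v x) \<ge> 0)}"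

definition nonneg_mat :: "real mat \<Rightarrow> bool" where
  "nonneg_mat A \<longleftrightarrow> (\<forall>i<dim_row A. \<forall>j<dim_col A. A $$ (i, j) \<ge> 0)"

definition cut_mat :: "nat \<Rightarrow> nat \<Rightarrow> nat \<Rightarrow> real mat" where
  "cut_mat m1 m2 m3 =
     four_block_mat
       (four_block_mat (0\<^sub>m m1 m1) (ones_mat m1 m2) (ones_mat m2 m1) (0\<^sub>m m2 m2))
       (0\<^sub>m (m1 + m2) m3) (0\<^sub>m m3 (m1 + m2)) (0\<^sub>m m3 m3)"


definition QAP_feasible :: "nat \<Rightarrow> nat \<times> nat \<Rightarrow> nat \<times> nat \<Rightarrow> real mat set" where
  "QAP_feasible n s r = {Y \<in> psd_mats (n^2). nonneg_mat Y \<and>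
     (\<forall>j<n. tr ((1\<^sub>m n \<otimes>\<^sub>m E_mat n j j) * Y) = 1 \<and> tr ((E_mat n j j \<otimes>\<^sub>m 1\<^sub>m n) * Y) = 1) \<and>
     tr ((1\<^sub>m n \<otimes>\<^sub>m (ones_mat n n - 1\<^sub>m n) + (ones_mat n n - 1\<^sub>m n) \<otimes>\<^sub>m 1\<^sub>m n) * Y) = 0 \<and>
     tr (ones_mat (n^2) (n^2) * Y) = real (n^2) \<and>
     tr ((E_mat n (fst s) (fst s) \<otimes>\<^sub>m E_mat n (fst r) (fst r)) * Y) = 1 \<and>
     tr ((E_mat n (snd s) (snd s) \<otimes>\<^sub>m E_mat n (snd r) (snd r)) * Y) = 1}"

definition QAP_objective :: "real mat \<Rightarrow> real mat \<Rightarrow> real mat \<Rightarrow> real" where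
  "QAP_objective A B Y = 1/2 * tr ((B \<otimes>\<^sub>m A) * Y)"

definition bordered_mat :: "real mat \<Rightarrow> real vec \<Rightarrow> real mat" where
  "bordered_mat Y y =
     four_block_mat (1\<^sub>m 1) (mat_of_rows (dim_vec y) [y]) (mat_of_cols (dim_vec y) [y]) Y"

definition GPP_feasible ::
    "nat \<Rightarrow> nat \<Rightarrow> nat \<Rightarrow> nat \<Rightarrow> nat \<times> nat \<Rightarrow> (real mat \<times> real vec) set" where
  "GPP_feasible n m1 m2 m3 r = {(Y, y).
     Y \<in> carrier_mat (3 * n) (3 * n) \<and> transpose_mat Y = Y \<and> y \<in> carrier_vec (3 * n) \<and>
     tr (((ones_mat 3 3 - 1\<^sub>m 3) \<otimes>\<^sub>m 1\<^sub>m n) * Y) = 0 \<and>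
     tr ((1\<^sub>m 3 \<otimes>\<^sub>m ones_mat n n) * Y) + tr Y =
       - (real (m1^2 + m2^2 + m3^2) + real n) +
       2 * (y \<bullet> ((vec_of_list [real m1, real m2, real m3] + ones_vec 3) \<otimes>\<^sub>v ones_vec n)) \<and>
     tr ((E_mat 3 0 0 \<otimes>\<^sub>m E_mat n (fst r) (fst r)) * Y) = 1 \<and>
     tr ((E_mat 3 1 1 \<otimes>\<^sub>m E_mat n (snd r) (snd r)) * Y) = 1 \<and>
     bordered_mat Y y \<in> psd_mats (3 * n + 1) \<and> nonneg_mat Y}"

definition GPP_objective :: "real mat \<Rightarrow> real mat \<times> real vec \<Rightarrow> real" where
  "GPP_objective A = (\<lambda>(Y, y). 1/2 * tr (((E_mat 3 0 1 + E_mat 3 1 0) \<otimes>\<^sub>m A) * Y))"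


text \<open>
  The entry of a point of the quadratic-assignment program with row \<open>(i, j)\<close> and column
  \<open>(k, l)\<close> (cut-graph vertices \<open>i, k\<close>, vertices \<open>j, l\<close> of the given graph) sits at
  \<open>(i * n + j, k * n + l)\<close>. An automorphism of the cut graph that fixes the chosen edge
  \<open>s\<close> acts on the indices \<open>i, k\<close>, and this action preserves the program. The
  partition program cannot tell apart points that differ only by averaging over this action: with
  part sizes \<open>(1, 3, 0)\<close> its feasible set is a single point, whereas the assignment program has the
  two feasible points \<open>x x\<^sup>T\<close>, where \<open>x\<close> is the vectorisation of one of the two permutation
  matrices that respect the prescribed edge. Hence the two feasible sets correspond
  bijectively only after the symmetry of the cut graph has been exploited, that is, for the
  invariant points; every other point is represented by its group average.
\<close>

definition cut_stabilizer :: "nat \<Rightarrow> nat \<Rightarrow> nat \<Rightarrow> nat \<times> nat \<Rightarrow> (nat \<Rightarrow> nat) set" where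
  "cut_stabilizer m1 m2 m3 s =
     {\<sigma> \<in> automorphisms (m1 + m2 + m3) (\<lambda>i j. cut_mat m1 m2 m3 $$ (i, j) = 1).
        \<sigma> (fst s) = fst s \<and> \<sigma> (snd s) = snd s}"

definition relabel :: "nat \<Rightarrow> (nat \<Rightarrow> nat) \<Rightarrow> real mat \<Rightarrow> real mat" where
  "relabel n \<sigma> Y = mat (n^2) (n^2)
     (\<lambda>(p, q). Y $$ (\<sigma> (p div n) * n + p mod n, \<sigma> (q div n) * n + q mod n))"

definition invariant_mats :: "nat \<Rightarrow> (nat \<Rightarrow> nat) set \<Rightarrow> real mat set" where
  "invariant_mats n \<Gamma> = {Y \<in> carrier_mat (n^2) (n^2). \<forall>\<sigma>\<in>\<Gamma>. relabel n \<sigma> Y = Y}"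

definition group_average :: "nat \<Rightarrow> (nat \<Rightarrow> nat) set \<Rightarrow> real mat \<Rightarrow> real mat" where
  "group_average n \<Gamma> Y = mat (n^2) (n^2)
     (\<lambda>(p, q). (\<Sum>\<sigma>\<in>\<Gamma>. relabel n \<sigma> Y $$ (p, q)) / real (card \<Gamma>))"

end

theory Submission
  imports Defs
begin

text \<open>
  Both programs are relaxations of sets of 0/1 matrices \<open>x\<close> with \<open>n\<close> columns whose columns sum to 1 and
  whose row \<open>i\<close> sums to a prescribed capacity. The assignment program has \<open>n\<close> rows (the vertices of the cut
  graph) of capacity 1, the partition program three rows (the parts) of capacities \<open>m1, m2, m3\<close>; the matrix
  variable stands for the products of the entries of \<open>x\<close>. Expanding the square of each linear equation
  (in the assignment program: of the difference of any two row equations or of any two column equations) gives a value that a positive semidefinite matrix cannot push below 0. The trace constraints say that the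
  sum of these values is 0, so every one of them is 0 and the corresponding vector lies in the kernel. Hence
  each feasible set is exactly the set of doubly indexed matrices called \<open>assignment_moment\<close> below, with the
  prescribed entries equal to 1 (\<open>QAP_feasible_iff\<close>, \<open>GPP_feasible_iff\<close>); in the partition program the
  bordering vector is forced to be the diagonal.
  
  The map \<open>\<Phi>\<close> sums the rows inside each part (\<open>aggregate\<close>). Linearity makes it feasible and
  objective preserving. Its inverse \<open>spread\<close> divides an entry of a partition point equally among the pairs of
  cut-graph vertices that can carry it. Those pairs form a single orbit of the stabilizer of the prescribed edge, so
  aggregating and then spreading is averaging over the stabilizer
  (\<open>stabilizer_average_eq_spread_aggregate\<close>), which fixes the invariant points.
  
  Two facts remain. An entry that no pair can carry must be 0 already in the partition program
  (\<open>coarse_zero_if_no_pair_slot\<close>); this makes aggregating after spreading the identity. And spreading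
  must preserve positive semidefiniteness (\<open>spread_psd\<close>): the spread form at a vector \<open>x\<close> exceeds the
  original form at the part means of \<open>x\<close> by a sum of variances inside the parts, weighted with nonnegative
  entries. Here the nonnegativity and the row sums enter (\<open>within_part_form_ge_mean_form\<close>).
\<close>

section \<open>Positive semidefinite forms\<close>

text \<open>
  Indexing by an arbitrary set lets the same statements serve pairs of indices and bordered matrices.
\<close>
definition psd_on :: "'a set \<Rightarrow> ('a \<Rightarrow> 'a \<Rightarrow> real) \<Rightarrow> bool" where
  "psd_on S F \<longleftrightarrow> (\<forall>a\<in>S. \<forall>b\<in>S. F a b = F b a) \<and>
     (\<forall>x. 0 \<le> (\<Sum>a\<in>S. \<Sum>b\<in>S. x a * F a b * x b))"

lemma psd_on_sym: "psd_on S F \<Longrightarrow> a \<in> S \<Longrightarrow> b \<in> S \<Longrightarrow> F a b = F b a"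
  unfolding psd_on_def by blast

lemma psd_on_nonneg: "psd_on S F \<Longrightarrow> 0 \<le> (\<Sum>a\<in>S. \<Sum>b\<in>S. x a * F a b * x b)"
  unfolding psd_on_def by blast

lemma psd_on_reindex:
  assumes "bij_betw h S T"
  shows "psd_on T F \<longleftrightarrow> psd_on S (\<lambda>a b. F (h a) (h b))"
proof -
  have im: "h ` S = T" and inj: "inj_on h S" using assms by (auto simp: bij_betw_def)
  have q: "(\<Sum>a\<in>T. \<Sum>b\<in>T. x a * F a b * x b) = (\<Sum>a\<in>S. \<Sum>b\<in>S. x (h a) * F (h a) (h b) * x (h b))" for x
    by (simp add: sum.reindex_bij_betw[OF assms, symmetric])
  have "(\<forall>x. 0 \<le> (\<Sum>a\<in>S. \<Sum>b\<in>S. x (h a) * F (h a) (h b) * x (h b))) \<longleftrightarrow>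
        (\<forall>x. 0 \<le> (\<Sum>a\<in>S. \<Sum>b\<in>S. x a * F (h a) (h b) * x b))" (is "?L \<longleftrightarrow> ?R")
  proof
    assume L: ?L
    show ?R
    proof
      fix x :: "'a \<Rightarrow> real"
      show "0 \<le> (\<Sum>a\<in>S. \<Sum>b\<in>S. x a * F (h a) (h b) * x b)"
        using L[rule_format, of "\<lambda>c. x (the_inv_into S h c)"]
        by (simp add: the_inv_into_f_f[OF inj] cong: sum.cong)
    qed
  next
    assume R: ?R
    show ?L
    proof
      fix x :: "'b \<Rightarrow> real"
      show "0 \<le> (\<Sum>a\<in>S. \<Sum>b\<in>S. x (h a) * F (h a) (h b) * x (h b))"
        using R[rule_format, of "\<lambda>c. x (h c)"] .
    qed
  qed
  moreover have "(\<forall>a\<in>T. \<forall>b\<in>T. F a b = F b a) \<longleftrightarrow> (\<forall>a\<in>S. \<forall>b\<in>S. F (h a) (h b) = F (h b) (h a))"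
    unfolding im[symmetric] by blast
  ultimately show ?thesis unfolding psd_on_def q by blast
qed

text \<open>
  Otherwise moving from a multiple of \<open>x\<close> by the basis vector of \<open>c\<close> would change the form linearly with
  nonzero slope, and it would become negative.
\<close>
lemma psd_on_kernel:
  assumes psd: "psd_on S F" and fin: "finite S"
    and zero: "(\<Sum>a\<in>S. \<Sum>b\<in>S. x a * F a b * x b) = 0" and c: "c \<in> S"
  shows "(\<Sum>b\<in>S. F c b * x b) = 0"
proof (rule ccontr)
  let ?e = "\<lambda>a. if a = c then 1 else (0::real)"
  define g where "g = (\<Sum>b\<in>S. F c b * x b)"
  assume "\<not> ?thesis"
  then have g0: "g \<noteq> 0" by (simp add: g_def)
  have expand: "(\<Sum>a\<in>S. \<Sum>b\<in>S. (t * x a + ?e a) * F a b * (t * x b + ?e b)) = 2 * t * g + F c c" for t :: real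
  proof -
    have "(\<Sum>a\<in>S. \<Sum>b\<in>S. (t * x a + ?e a) * F a b * (t * x b + ?e b)) =
      t * t * (\<Sum>a\<in>S. \<Sum>b\<in>S. x a * F a b * x b) + t * (\<Sum>a\<in>S. \<Sum>b\<in>S. x a * F a b * ?e b)
      + t * (\<Sum>a\<in>S. \<Sum>b\<in>S. ?e a * F a b * x b) + (\<Sum>a\<in>S. \<Sum>b\<in>S. ?e a * F a b * ?e b)"
      by (simp only: sum_distrib_left sum.distrib[symmetric]) (intro sum.cong refl; simp only: algebra_simps)
    also have "(\<Sum>a\<in>S. \<Sum>b\<in>S. x a * F a b * ?e b) = (\<Sum>a\<in>S. x a * F a c)"
      using c fin by (intro sum.cong refl) (simp add: if_distrib[of "\<lambda>z. _ * z"] sum.delta cong: if_cong)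
    also have "\<dots> = g" unfolding g_def using psd_on_sym[OF psd _ c] by (intro sum.cong refl) simp
    also have "(\<Sum>a\<in>S. \<Sum>b\<in>S. ?e a * F a b * x b) = (\<Sum>a\<in>S. ?e a * (\<Sum>b\<in>S. F a b * x b))"
      by (simp add: sum_distrib_left mult.assoc)
    also have "\<dots> = g" using c fin by (simp add: g_def if_distrib[of "\<lambda>z. z * _"] cong: if_cong)
    also have "(\<Sum>a\<in>S. \<Sum>b\<in>S. ?e a * F a b * ?e b) = (\<Sum>a\<in>S. ?e a * (\<Sum>b\<in>S. F a b * ?e b))"
      by (simp add: sum_distrib_left mult.assoc)
    also have "\<dots> = F c c"
      using c fin by (simp add: if_distrib[of "\<lambda>z. z * _"] if_distrib[of "\<lambda>z. _ * z"] sum.delta cong: if_cong)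
    finally show ?thesis using zero by simp
  qed
  have "0 \<le> 2 * t * g + F c c" for t
    using psd_on_nonneg[OF psd, of "\<lambda>a. t * x a + ?e a"] unfolding expand .
  \<comment> \<open>This \<open>t\<close> makes the linear function equal to \<open>- 1\<close>.\<close>
  from this[of "- (F c c + 1) / (2 * g)"] g0 show False by (simp add: field_simps)
qed

section \<open>Variance inside a part\<close>

text \<open>
  After multiplication by \<open>card I - 1\<close>, the difference of the two sides is half the sum of \<open>W j l\<close> times the
  variance over \<open>I\<close> of \<open>x i j - x i l\<close>: the row sum condition says that \<open>card I\<close> times the diagonal of
  \<open>W\<close> minus \<open>W\<close> is a weighted graph Laplacian. For a single row that condition forces \<open>W\<close> to be diagonal, and
  for no row both sides vanish because division by 0 gives 0.
\<close>
lemma within_part_form_ge_mean_form: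
  fixes W :: "'b \<Rightarrow> 'b \<Rightarrow> real" and x :: "'a \<Rightarrow> 'b \<Rightarrow> real"
  defines "N \<equiv> \<lambda>I j l. {(i, k). i \<in> I \<and> k \<in> I \<and> (i = k \<longleftrightarrow> j = l)}"
  assumes fI: "finite I" and fJ: "finite J"
    and sym: "\<And>j l. j \<in> J \<Longrightarrow> l \<in> J \<Longrightarrow> W j l = W l j"
    and nonneg: "\<And>j l. j \<in> J \<Longrightarrow> l \<in> J \<Longrightarrow> 0 \<le> W j l"
    and row: "\<And>j. j \<in> J \<Longrightarrow> (\<Sum>l\<in>J. W j l) = real (card I) * W j j"
  shows "(\<Sum>j\<in>J. \<Sum>l\<in>J. W j l * ((\<Sum>i\<in>I. x i j) / card I * ((\<Sum>i\<in>I. x i l) / card I)))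
    \<le> (\<Sum>j\<in>J. \<Sum>l\<in>J. W j l * ((\<Sum>(i, k)\<in>N I j l. x i j * x k l) / card (N I j l)))"
proof -
  define m where "m = real (card I)"
  define A where "A j = (\<Sum>i\<in>I. x i j) / m" for j
  define C where "C j l = (\<Sum>i\<in>I. x i j * x i l) / m - A j * A l" for j l
  define T where "T j l = (\<Sum>(i, k)\<in>N I j l. x i j * x k l) / card (N I j l)" for j l
  have Ndiag: "N I j j = (\<lambda>i. (i, i)) ` I" for j by (auto simp: N_def)
  have Noff: "N I j l = I \<times> I - (\<lambda>i. (i, i)) ` I" if "j \<noteq> l" for j l using that by (auto simp: N_def)
  have injd: "inj_on (\<lambda>i. (i, i)) I" by (auto simp: inj_on_def)
  have Tdiag: "T j j - A j * A j = C j j" for j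
    unfolding T_def C_def Ndiag by (simp add: sum.reindex[OF injd] card_image[OF injd] m_def)
  have cardoff: "real (card (N I j l)) = m * (m - 1)" if "j \<noteq> l" for j l
  proof -
    have "card (N I j l) = card I * card I - card I"
      unfolding Noff[OF that] using fI
      by (subst card_Diff_subset) (auto simp: card_image[OF injd] card_cartesian_product)
    then show ?thesis by (simp add: m_def algebra_simps of_nat_diff)
  qed
  have sumoff: "(\<Sum>(i, k)\<in>N I j l. x i j * x k l) = (\<Sum>i\<in>I. x i j) * (\<Sum>i\<in>I. x i l) - (\<Sum>i\<in>I. x i j * x i l)"
    if "j \<noteq> l" for j l
    unfolding Noff[OF that] using fI
    by (subst sum_diff) (auto simp: sum.reindex[OF injd] sum_product sum.cartesian_product)
  show ?thesis
  proof (cases "m = 0")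
    case True
    then have "I = {}" using fI by (simp add: m_def)
    then show ?thesis by (simp add: N_def)
  next
    case False
    then have m1: "m \<ge> 1" and mI: "card I > 0" by (auto simp: m_def)
    have off: "(m - 1) * (W j l * (T j l - A j * A l)) = - W j l * C j l"
      if "j \<in> J" "l \<in> J" "j \<noteq> l" for j l
    proof (cases "m = 1")
      case True
      have "(\<Sum>l\<in>J - {j}. W j l) = 0"
        using row[OF that(1)] True sum.remove[OF fJ that(1), of "W j"] by (simp add: m_def)
      then have "W j l = 0"
        using sum_nonneg_eq_0_iff[of "J - {j}" "W j"] that fJ nonneg[OF that(1)] by auto
      then show ?thesis by simp
    next
      case False
      then have "m - 1 \<noteq> 0" "m \<noteq> 0" using m1 by auto
      then show ?thesis unfolding T_def cardoff[OF that(3)] sumoff[OF that(3)] C_def A_def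
        by (simp add: field_simps)
    qed
    \<comment> \<open>The combination is the variance of \<open>x i j - x i l\<close> over \<open>i\<close>.\<close>
    have var: "0 \<le> C j j + C l l - 2 * C j l" for j l
    proof -
      define d where "d i = x i j - x i l" for i
      have eq: "C j j + C l l - 2 * C j l = (\<Sum>i\<in>I. (d i)^2) / m - ((\<Sum>i\<in>I. d i) / m)^2"
        unfolding C_def A_def d_def
        by (simp add: power2_eq_square algebra_simps sum.distrib sum_subtractf
            diff_divide_distrib add_divide_distrib sum_distrib_left[symmetric])
      define e where "e = (\<Sum>i\<in>I. d i) / m"
      have "(\<Sum>i\<in>I. (d i - e)^2) = (\<Sum>i\<in>I. (d i)^2) - (\<Sum>i\<in>I. 2 * e * d i) + m * e^2"
        by (simp add: power2_diff sum.distrib sum_subtractf m_def algebra_simps)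
      also have "(\<Sum>i\<in>I. 2 * e * d i) = 2 * e * (m * e)"
        unfolding sum_distrib_left[symmetric] using False by (simp add: e_def)
      finally have "(\<Sum>i\<in>I. (d i - e)^2) = m * ((\<Sum>i\<in>I. (d i)^2) / m - e^2)"
        using False by (simp add: power2_eq_square right_diff_distrib)
      moreover have "0 \<le> (\<Sum>i\<in>I. (d i - e)^2)" by (simp add: sum_nonneg)
      ultimately have "0 \<le> m * ((\<Sum>i\<in>I. (d i)^2) / m - e^2)" by simp
      then show ?thesis unfolding eq e_def using m1 by (simp add: zero_le_mult_iff)
    qed
    define D where "D = (\<Sum>j\<in>J. \<Sum>l\<in>J. W j l * (T j l - A j * A l))"
    have nn: "0 \<le> (\<Sum>j\<in>J. \<Sum>l\<in>J. W j l * (C j j - C j l))"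
    proof -
      have sw: "(\<Sum>j\<in>J. \<Sum>l\<in>J. W j l * (C j j - C j l)) = (\<Sum>j\<in>J. \<Sum>l\<in>J. W j l * (C l l - C j l))"
        by (subst sum.swap) (intro sum.cong refl, simp add: sym C_def mult.commute)
      have "(\<Sum>j\<in>J. \<Sum>l\<in>J. W j l * (C j j - C j l)) + (\<Sum>j\<in>J. \<Sum>l\<in>J. W j l * (C l l - C j l))
        = (\<Sum>j\<in>J. \<Sum>l\<in>J. W j l * (C j j + C l l - 2 * C j l))"
        by (simp only: sum.distrib[symmetric]) (intro sum.cong refl; simp add: algebra_simps)
      also have "\<dots> \<ge> 0" by (intro sum_nonneg mult_nonneg_nonneg nonneg var)
      finally show ?thesis using sw by linarith
    qed
    \<comment> \<open>The row sum condition turns the diagonal into the diagonal of the Laplacian.\<close>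
    have scaled: "(m - 1) * D = (\<Sum>j\<in>J. \<Sum>l\<in>J. W j l * (C j j - C j l))"
    proof -
      have "(m - 1) * (\<Sum>l\<in>J. W j l * (T j l - A j * A l)) = (\<Sum>l\<in>J. W j l * (C j j - C j l))"
        if j: "j \<in> J" for j
      proof -
        have "(m - 1) * (\<Sum>l\<in>J. W j l * (T j l - A j * A l))
          = (m - 1) * (W j j * C j j) + (\<Sum>l\<in>J - {j}. (m - 1) * (W j l * (T j l - A j * A l)))"
          by (subst sum.remove[OF fJ j]) (simp add: Tdiag distrib_left sum_distrib_left)
        also have "(\<Sum>l\<in>J - {j}. (m - 1) * (W j l * (T j l - A j * A l))) = (\<Sum>l\<in>J - {j}. - W j l * C j l)"
          by (intro sum.cong refl, rule off) (use j in auto)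
        also have "\<dots> = W j j * C j j - (\<Sum>l\<in>J. W j l * C j l)"
          by (subst sum.remove[OF fJ j]) (simp add: sum_negf)
        also have "(m - 1) * (W j j * C j j) + (W j j * C j j - (\<Sum>l\<in>J. W j l * C j l))
           = (\<Sum>l\<in>J. W j l) * C j j - (\<Sum>l\<in>J. W j l * C j l)"
          unfolding row[OF j] m_def by (simp add: algebra_simps)
        also have "\<dots> = (\<Sum>l\<in>J. W j l * (C j j - C j l))"
          by (simp add: sum_distrib_right right_diff_distrib sum_subtractf)
        finally show ?thesis .
      qed
      then show ?thesis unfolding D_def by (subst sum_distrib_left) (rule sum.cong[OF refl])
    qed
    have "0 \<le> D"
    proof (cases "m = 1")
      case True
      then obtain i0 where I: "I = {i0}" using card_1_singletonE[of I] by (auto simp: m_def)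
      have "W j l * (T j l - A j * A l) = 0" if "j \<in> J" "l \<in> J" for j l
      proof (cases "j = l")
        case True
        then show ?thesis using Tdiag[of l] by (simp add: C_def A_def I m_def)
      next
        case False
        have "(\<Sum>l\<in>J - {j}. W j l) = 0"
          using row[OF that(1)] \<open>m = 1\<close> sum.remove[OF fJ that(1), of "W j"] by (simp add: m_def)
        then have "W j l = 0"
          using sum_nonneg_eq_0_iff[of "J - {j}" "W j"] that False fJ nonneg[OF that(1)] by auto
        then show ?thesis by simp
      qed
      then have "D = 0" unfolding D_def by (intro sum.neutral ballI)
      then show ?thesis by simp
    next
      case False
      then show ?thesis using scaled nn m1 by (metis diff_gt_0_iff_gt less_eq_real_def zero_le_mult_iff not_less)
    qed
    then have "(\<Sum>j\<in>J. \<Sum>l\<in>J. W j l * (A j * A l)) \<le> (\<Sum>j\<in>J. \<Sum>l\<in>J. W j l * T j l)"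
      unfolding D_def by (simp add: right_diff_distrib sum_subtractf)
    then show ?thesis by (simp only: A_def T_def m_def)
  qed
qed

section \<open>Moment matrices of assignments\<close>

text \<open>
  The matrix \<open>F\<close> plays the role of \<open>E (x\<^sub>a x\<^sub>b)\<close> for a random 0/1 matrix \<open>x\<close> with \<open>p\<close> rows and
  \<open>n\<close> columns, row sums \<open>m i\<close> and column sums 1; the diagonal then stands for the expectation of \<open>x\<close>
  itself. The conditions are the consequences of those linear equations for the second moments.
\<close>
definition assignment_moment ::
    "nat \<Rightarrow> nat \<Rightarrow> (nat \<Rightarrow> nat) \<Rightarrow> (nat \<times> nat \<Rightarrow> nat \<times> nat \<Rightarrow> real) \<Rightarrow> bool" where
  "assignment_moment p n m F \<longleftrightarrow> psd_on ({..<p} \<times> {..<n}) F \<and>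
     (\<forall>i<p. \<forall>j<n. \<forall>k<p. \<forall>l<n. 0 \<le> F (i, j) (k, l)) \<and>
     (\<forall>i<p. \<forall>k<p. \<forall>j<n. i \<noteq> k \<longrightarrow> F (i, j) (k, j) = 0) \<and>
     (\<forall>i<p. \<forall>j<n. \<forall>k<p. (\<Sum>l<n. F (i, j) (k, l)) = real (m k) * F (i, j) (i, j)) \<and>
     (\<forall>i<p. \<forall>j<n. \<forall>l<n. (\<Sum>k<p. F (i, j) (k, l)) = F (i, j) (i, j)) \<and>
     (\<forall>i<p. (\<Sum>j<n. F (i, j) (i, j)) = real (m i)) \<and>
     (\<forall>j<n. (\<Sum>i<p. F (i, j) (i, j)) = 1)"

context
  fixes p n m F
  assumes M: "assignment_moment p n m F"
begin

lemma moment_psd: "psd_on ({..<p} \<times> {..<n}) F"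
  and moment_nonneg: "i < p \<Longrightarrow> j < n \<Longrightarrow> k < p \<Longrightarrow> l < n \<Longrightarrow> 0 \<le> F (i, j) (k, l)"
  and moment_same_column: "i < p \<Longrightarrow> k < p \<Longrightarrow> j < n \<Longrightarrow> i \<noteq> k \<Longrightarrow> F (i, j) (k, j) = 0"
  and moment_row_sum: "i < p \<Longrightarrow> j < n \<Longrightarrow> k < p \<Longrightarrow> (\<Sum>l<n. F (i, j) (k, l)) = real (m k) * F (i, j) (i, j)"
  and moment_column_sum: "i < p \<Longrightarrow> j < n \<Longrightarrow> l < n \<Longrightarrow> (\<Sum>k<p. F (i, j) (k, l)) = F (i, j) (i, j)"
  and moment_row_marginal: "i < p \<Longrightarrow> (\<Sum>j<n. F (i, j) (i, j)) = real (m i)"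
  and moment_column_marginal: "j < n \<Longrightarrow> (\<Sum>i<p. F (i, j) (i, j)) = 1"
  using M by (simp_all add: assignment_moment_def)

lemma moment_sym: "i < p \<Longrightarrow> j < n \<Longrightarrow> k < p \<Longrightarrow> l < n \<Longrightarrow> F (i, j) (k, l) = F (k, l) (i, j)"
  using psd_on_sym[OF moment_psd] by auto

lemma moment_zero_row:
  assumes "i < p" "j < n" "k < p" "l < n" "F (i, j) (i, j) = 0"
  shows "F (i, j) (k, l) = 0"
proof -
  have "(\<Sum>l<n. F (i, j) (k, l)) = 0" using moment_row_sum[of i j k] assms by simp
  then show ?thesis
    using sum_nonneg_eq_0_iff[of "{..<n}" "\<lambda>l. F (i, j) (k, l)"] moment_nonneg assms by auto
qed

lemma moment_pin_other_row:
  assumes "i0 < p" "j0 < n" "F (i0, j0) (i0, j0) = 1" "i < p" "i \<noteq> i0"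
  shows "F (i, j0) (i, j0) = 0"
proof -
  have "(\<Sum>i\<in>{..<p} - {i0}. F (i, j0) (i, j0)) = 0"
    using moment_column_marginal[of j0] assms sum.remove[of "{..<p}" i0 "\<lambda>i. F (i, j0) (i, j0)"] by simp
  then show ?thesis
    using sum_nonneg_eq_0_iff[of "{..<p} - {i0}" "\<lambda>i. F (i, j0) (i, j0)"] moment_nonneg assms by auto
qed

lemma moment_pin_other_column:
  assumes "i0 < p" "j0 < n" "F (i0, j0) (i0, j0) = 1" "j < n" "j \<noteq> j0" "m i0 = 1"
  shows "F (i0, j) (i0, j) = 0"
proof -
  have "(\<Sum>j\<in>{..<n} - {j0}. F (i0, j) (i0, j)) = 0"
    using moment_row_marginal[of i0] assms sum.remove[of "{..<n}" j0 "\<lambda>j. F (i0, j) (i0, j)"] by simp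
  then show ?thesis
    using sum_nonneg_eq_0_iff[of "{..<n} - {j0}" "\<lambda>j. F (i0, j) (i0, j)"] moment_nonneg assms by auto
qed

lemma moment_pin_column:
  assumes "i0 < p" "j0 < n" "F (i0, j0) (i0, j0) = 1" "i < p" "j < n" "k < p"
  shows "F (i, j) (k, j0) = (if k = i0 then F (i, j) (i, j) else 0)"
proof -
  have z: "F (i, j) (k, j0) = 0" if "k < p" "k \<noteq> i0" for k
    using moment_zero_row[of k j0 i j] moment_pin_other_row[of i0 j0 k] moment_sym[of i j k j0] assms that by simp
  have "F (i, j) (i, j) = (\<Sum>k<p. F (i, j) (k, j0))" using moment_column_sum assms by simp
  also have "\<dots> = F (i, j) (i0, j0) + (\<Sum>k\<in>{..<p} - {i0}. F (i, j) (k, j0))"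
    using assms by (subst sum.remove[of _ i0]) auto
  also have "(\<Sum>k\<in>{..<p} - {i0}. F (i, j) (k, j0)) = 0" using z by (intro sum.neutral) auto
  finally show ?thesis using z assms by auto
qed

lemma moment_same_row:
  assumes "i < p" "j < n" "l < n" "j \<noteq> l" "m i = 1"
  shows "F (i, j) (i, l) = 0"
proof -
  have "(\<Sum>l\<in>{..<n} - {j}. F (i, j) (i, l)) = 0"
    using moment_row_sum[of i j i] assms sum.remove[of "{..<n}" j "\<lambda>l. F (i, j) (i, l)"] by simp
  then show ?thesis
    using sum_nonneg_eq_0_iff[of "{..<n} - {j}" "\<lambda>l. F (i, j) (i, l)"] moment_nonneg assms by auto
qed

end

lemma psd_on_indicator_form:
  fixes x :: "nat \<Rightarrow> real"
  shows "(\<Sum>a\<in>{..<p} \<times> {..<n}. \<Sum>b\<in>{..<p} \<times> {..<n}. x (fst a) * F a b * x (fst b)) =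
    (\<Sum>i<p. \<Sum>k<p. x i * x k * (\<Sum>j<n. \<Sum>l<n. F (i, j) (k, l)))"
proof -
  have "(\<Sum>a\<in>{..<p} \<times> {..<n}. \<Sum>b\<in>{..<p} \<times> {..<n}. x (fst a) * F a b * x (fst b)) =
    (\<Sum>i<p. \<Sum>j<n. \<Sum>k<p. \<Sum>l<n. x i * F (i, j) (k, l) * x k)"
    by (simp add: sum.cartesian_product')
  also have "\<dots> = (\<Sum>i<p. \<Sum>k<p. \<Sum>j<n. \<Sum>l<n. x i * F (i, j) (k, l) * x k)"
    by (intro sum.cong refl sum.swap)
  finally show ?thesis by (simp add: sum_distrib_left mult_ac)
qed

text \<open>
  The inner product \<open>g i k\<close>, with respect to the form \<open>F\<close>, of the indicators of rows \<open>i\<close> and \<open>k\<close> is at most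
  1, since both have norm 1. The total
  \<open>n^2\<close> leaves no slack, so all inner products are 1 and the difference of two row indicators has norm 0,
  which puts it in the kernel.
\<close>
lemma row_sum_of_unit_blocks:
  assumes psd: "psd_on ({..<n} \<times> {..<n}) F"
    and diag: "\<And>i j l. i < n \<Longrightarrow> j < n \<Longrightarrow> l < n \<Longrightarrow> j \<noteq> l \<Longrightarrow> F (i, j) (i, l) = 0"
    and unit: "\<And>i. i < n \<Longrightarrow> (\<Sum>j<n. F (i, j) (i, j)) = 1"
    and total: "(\<Sum>i<n. \<Sum>k<n. \<Sum>j<n. \<Sum>l<n. F (i, j) (k, l)) = real (n^2)"
    and i: "i < n" and j: "j < n" and k: "k < n"
  shows "(\<Sum>l<n. F (i, j) (k, l)) = F (i, j) (i, j)"
proof -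
  define g where "g i k = (\<Sum>j<n. \<Sum>l<n. F (i, j) (k, l))" for i k
  have row_i: "(\<Sum>l<n. F (i, j) (i, l)) = F (i, j) (i, j)" if "i < n" "j < n" for i j
    using diag that by (subst sum.remove[of _ j]) auto
  have gd: "g i i = 1" if "i < n" for i
    unfolding g_def using row_i unit that by simp
  have gs: "g i k = g k i" if "i < n" "k < n" for i k
    unfolding g_def using that psd_on_sym[OF psd] by (subst sum.swap) (intro sum.cong refl, auto)
  let ?x = "\<lambda>i k a. if a = i then 1 else if a = k then -1 else (0::real)"
  have form: "(\<Sum>a\<in>{..<n} \<times> {..<n}. \<Sum>b\<in>{..<n} \<times> {..<n}. ?x i k (fst a) * F a b * ?x i k (fst b)) = 2 - 2 * g i k"
    if ik: "i < n" "k < n" "i \<noteq> k" for i k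
  proof -
    have two: "(\<Sum>a<n. ?x i k a * h a) = h i - h k" for h :: "nat \<Rightarrow> real"
    proof -
      have "(\<Sum>a<n. ?x i k a * h a) = (\<Sum>a<n. (if a = i then h a else 0) - (if a = k then h a else 0))"
        using ik by (intro sum.cong) auto
      then show ?thesis using ik by (simp add: sum_subtractf)
    qed
    have "(\<Sum>a\<in>{..<n} \<times> {..<n}. \<Sum>b\<in>{..<n} \<times> {..<n}. ?x i k (fst a) * F a b * ?x i k (fst b))
       = (\<Sum>a<n. \<Sum>b<n. ?x i k a * ?x i k b * g a b)"
      unfolding g_def by (rule psd_on_indicator_form[where x = "?x i k"])
    also have "\<dots> = (\<Sum>a<n. ?x i k a * (\<Sum>b<n. ?x i k b * g a b))"
      by (simp only: sum_distrib_left mult.assoc)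
    also have "\<dots> = g i i - g i k - (g k i - g k k)" unfolding two ..
    finally show ?thesis using gd gs ik by simp
  qed
  have le: "0 \<le> 1 - g i k" if "i < n" "k < n" for i k
  proof (cases "i = k")
    case False
    then show ?thesis
      using psd_on_nonneg[OF psd, of "\<lambda>a. ?x i k (fst a)"] unfolding form[OF that False] by linarith
  qed (simp add: gd that)
  have "(\<Sum>i<n. \<Sum>k<n. 1 - g i k) = 0"
    using total unfolding g_def[symmetric] by (simp add: sum_subtractf power2_eq_square)
  then have "\<forall>i<n. (\<Sum>k<n. 1 - g i k) = 0"
    by (subst (asm) sum_nonneg_eq_0_iff) (auto intro!: sum_nonneg le)
  then have "(\<Sum>k<n. 1 - g i k) = 0" using i by blast
  then have one: "g i k = 1"
    by (subst (asm) sum_nonneg_eq_0_iff) (use k i le in auto)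
  show ?thesis
  proof (cases "i = k")
    case True
    then show ?thesis using row_i i j by simp
  next
    case False
    have "(\<Sum>b\<in>{..<n} \<times> {..<n}. F (i, j) b * ?x i k (fst b)) = 0"
    proof (rule psd_on_kernel[OF psd])
      show "(\<Sum>a\<in>{..<n} \<times> {..<n}. \<Sum>b\<in>{..<n} \<times> {..<n}. ?x i k (fst a) * F a b * ?x i k (fst b)) = 0"
        unfolding form[OF i k False] one by simp
    qed (use i j in auto)
    then have "(\<Sum>a<n. ?x i k a * (\<Sum>l<n. F (i, j) (a, l))) = 0"
      by (simp only: sum.cartesian_product' sum_distrib_left mult.commute[of "F _ _"] fst_conv)
    moreover have "(\<Sum>a<n. ?x i k a * (\<Sum>l<n. F (i, j) (a, l))) =
       (\<Sum>a<n. (if a = i then \<Sum>l<n. F (i, j) (a, l) else 0) - (if a = k then \<Sum>l<n. F (i, j) (a, l) else 0))"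
      using False by (intro sum.cong) auto
    ultimately show ?thesis using i k row_i[OF i j] by (simp add: sum_subtractf)
  qed
qed

lemma psd_on_swap:
  "psd_on (A \<times> B) F \<longleftrightarrow> psd_on (B \<times> A) (\<lambda>(j, i) (l, k). F (i, j) (k, l))"
proof -
  have "bij_betw prod.swap (B \<times> A) (A \<times> B)"
    by (rule bij_betw_byWitness[of _ prod.swap]) auto
  from psd_on_reindex[OF this, of F] show ?thesis by (simp add: case_prod_unfold prod.swap_def)
qed

text \<open>
  With unit capacities the row and column sums follow from the single equation for the total. Rows and columns
  play symmetric roles here, so the column sums come from the row sums of the transposed index set.
\<close>
lemma assignment_moment_iff_total:
  "assignment_moment n n (\<lambda>_. 1) F \<longleftrightarrow>
     psd_on ({..<n} \<times> {..<n}) F \<and>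
     (\<forall>i<n. \<forall>j<n. \<forall>k<n. \<forall>l<n. 0 \<le> F (i, j) (k, l)) \<and>
     (\<forall>j<n. (\<Sum>i<n. F (i, j) (i, j)) = 1) \<and> (\<forall>i<n. (\<Sum>j<n. F (i, j) (i, j)) = 1) \<and>
     (\<forall>i<n. \<forall>j<n. \<forall>k<n. \<forall>l<n. (i = k) \<noteq> (j = l) \<longrightarrow> F (i, j) (k, l) = 0) \<and>
     (\<Sum>i<n. \<Sum>j<n. \<Sum>k<n. \<Sum>l<n. F (i, j) (k, l)) = real (n^2)"
    (is "?L \<longleftrightarrow> ?R")
proof
  assume L: ?L
  have "(\<Sum>i<n. \<Sum>j<n. \<Sum>k<n. \<Sum>l<n. F (i, j) (k, l)) = (\<Sum>i<n. \<Sum>j<n. real n * F (i, j) (i, j))"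
    using moment_row_sum[OF L] by simp
  also have "\<dots> = real (n^2)"
    using moment_row_marginal[OF L] by (simp add: sum_distrib_left[symmetric] power2_eq_square)
  finally have total: "(\<Sum>i<n. \<Sum>j<n. \<Sum>k<n. \<Sum>l<n. F (i, j) (k, l)) = real (n^2)" .
  have pattern: "F (i, j) (k, l) = 0" if "i < n" "j < n" "k < n" "l < n" "(i = k) \<noteq> (j = l)" for i j k l
    using that moment_same_column[OF L, of i k j] moment_same_row[OF L, of i j l] by (cases "i = k") simp_all
  have "(\<Sum>j<n. F (i, j) (i, j)) = 1" if "i < n" for i using moment_row_marginal[OF L that] by simp
  then show ?R
    by (intro conjI allI impI moment_psd[OF L] moment_nonneg[OF L] moment_column_marginal[OF L] total pattern)
next
  assume R: ?R
  then have psd: "psd_on ({..<n} \<times> {..<n}) F" by blast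
  have row: "(\<Sum>l<n. F (i, j) (k, l)) = F (i, j) (i, j)" if "i < n" "j < n" "k < n" for i j k
  proof (rule row_sum_of_unit_blocks[OF psd _ _ _ that])
    have "(\<Sum>i<n. \<Sum>k<n. \<Sum>j<n. \<Sum>l<n. F (i, j) (k, l)) = (\<Sum>i<n. \<Sum>j<n. \<Sum>k<n. \<Sum>l<n. F (i, j) (k, l))"
      by (intro sum.cong refl sum.swap)
    then show "(\<Sum>i<n. \<Sum>k<n. \<Sum>j<n. \<Sum>l<n. F (i, j) (k, l)) = real (n\<^sup>2)"
      using R by simp
  qed (use R in auto)
  have col: "(\<Sum>k<n. F (i, j) (k, l)) = F (i, j) (i, j)" if "i < n" "j < n" "l < n" for i j l
  proof -
    let ?G = "\<lambda>(j, i) (l, k). F (i, j) (k, l)"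
    have "(\<Sum>k<n. ?G (j, i) (l, k)) = ?G (j, i) (j, i)"
    proof (rule row_sum_of_unit_blocks[OF psd[unfolded psd_on_swap[of _ _ F]]])
      have "(\<Sum>j<n. \<Sum>l<n. \<Sum>i<n. \<Sum>k<n. F (i, j) (k, l)) = (\<Sum>j<n. \<Sum>i<n. \<Sum>l<n. \<Sum>k<n. F (i, j) (k, l))"
        by (intro sum.cong refl sum.swap)
      also have "\<dots> = (\<Sum>i<n. \<Sum>j<n. \<Sum>k<n. \<Sum>l<n. F (i, j) (k, l))"
        by (subst sum.swap) (intro sum.cong refl sum.swap)
      finally show "(\<Sum>j<n. \<Sum>l<n. \<Sum>i<n. \<Sum>k<n. ?G (j, i) (l, k)) = real (n\<^sup>2)"
        using R by simp
    qed (use R that in auto)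
    then show ?thesis by simp
  qed
  have nonneg: "0 \<le> F (i, j) (k, l)" if "i < n" "j < n" "k < n" "l < n" for i j k l
    using R[THEN conjunct2, THEN conjunct1] that by simp
  have column: "F (i, j) (k, j) = 0" if "i < n" "k < n" "j < n" "i \<noteq> k" for i j k
    using R[THEN conjunct2, THEN conjunct2, THEN conjunct2, THEN conjunct2, THEN conjunct1] that by simp
  have marginals: "(\<Sum>j<n. F (i, j) (i, j)) = 1" "(\<Sum>j<n. F (j, i) (j, i)) = 1" if "i < n" for i
    using R that by simp_all
  show ?L unfolding assignment_moment_def of_nat_1 mult_1
    using psd nonneg column row col marginals by simp
qed

section \<open>Aggregating and spreading along a partition\<close>

text \<open>
  The rows \<open>{..<n}\<close> are grouped by \<open>part\<close>; a pin \<open>(s, r)\<close> prescribes that row \<open>s\<close> is assigned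
  to column \<open>r\<close>. For the cut graph the rows are its vertices and the two pins come from the prescribed edge.
\<close>
locale pinned_partition =
  fixes n q :: nat and part :: "nat \<Rightarrow> nat" and Q :: "(nat \<times> nat) set"
  assumes part_less: "i < n \<Longrightarrow> part i < q"
    and pins: "Q \<subseteq> {..<n} \<times> {..<n}" and inj_fst: "inj_on fst Q" and inj_snd: "inj_on snd Q"
begin

definition cell :: "nat \<Rightarrow> nat set" where
  "cell a = {i \<in> {..<n}. part i = a}"

text \<open>
  A 0/1 matrix respecting the pins can have a 1 at \<open>(i, j)\<close> only if this holds.
\<close>
definition compat :: "nat \<Rightarrow> nat \<Rightarrow> bool" where
  "compat i j \<longleftrightarrow> (\<forall>(s, r)\<in>Q. i = s \<longleftrightarrow> j = r)"

definition slots :: "nat \<Rightarrow> nat \<Rightarrow> nat set" where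
  "slots a j = {i \<in> cell a. compat i j}"

text \<open>
  The pairs of rows from the parts \<open>a\<close> and \<open>b\<close> that can be assigned to the columns \<open>j\<close> and \<open>l\<close>: distinct
  rows go to distinct columns.
\<close>
definition pair_slots :: "nat \<Rightarrow> nat \<Rightarrow> nat \<Rightarrow> nat \<Rightarrow> (nat \<times> nat) set" where
  "pair_slots a j b l = {(i, k). i \<in> slots a j \<and> k \<in> slots b l \<and> (i = k \<longleftrightarrow> j = l)}"

definition free_rows :: "nat \<Rightarrow> nat set" where
  "free_rows a = cell a - fst ` Q"

definition free_columns :: "nat set" where
  "free_columns = {..<n} - snd ` Q"

definition aggregate :: "(nat \<times> nat \<Rightarrow> nat \<times> nat \<Rightarrow> real) \<Rightarrow> nat \<times> nat \<Rightarrow> nat \<times> nat \<Rightarrow> real" where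
  "aggregate F = (\<lambda>(a, j) (b, l). \<Sum>i\<in>cell a. \<Sum>k\<in>cell b. F (i, j) (k, l))"

definition spread :: "(nat \<times> nat \<Rightarrow> nat \<times> nat \<Rightarrow> real) \<Rightarrow> nat \<times> nat \<Rightarrow> nat \<times> nat \<Rightarrow> real" where
  "spread G = (\<lambda>(i, j) (k, l).
     if (i, k) \<in> pair_slots (part i) j (part k) l
     then G (part i, j) (part k, l) / real (card (pair_slots (part i) j (part k) l)) else 0)"

definition stabilizer :: "(nat \<Rightarrow> nat) set" where
  "stabilizer = {\<sigma>. \<sigma> permutes {..<n} \<and> (\<forall>i<n. part (\<sigma> i) = part i) \<and> (\<forall>(s, r)\<in>Q. \<sigma> s = s)}"

definition fine_moment :: "(nat \<times> nat \<Rightarrow> nat \<times> nat \<Rightarrow> real) \<Rightarrow> bool" where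
  "fine_moment F \<longleftrightarrow> assignment_moment n n (\<lambda>_. 1) F \<and> (\<forall>(s, r)\<in>Q. F (s, r) (s, r) = 1)"

definition coarse_moment :: "(nat \<times> nat \<Rightarrow> nat \<times> nat \<Rightarrow> real) \<Rightarrow> bool" where
  "coarse_moment G \<longleftrightarrow> assignment_moment q n (\<lambda>a. card (cell a)) G \<and>
     (\<forall>(s, r)\<in>Q. G (part s, r) (part s, r) = 1)"

lemma aggregate_apply: "aggregate F (a, j) (b, l) = (\<Sum>i\<in>cell a. \<Sum>k\<in>cell b. F (i, j) (k, l))"
  by (simp add: aggregate_def)

lemma finite_cell [simp]: "finite (cell a)"
  and finite_slots [simp]: "finite (slots a j)"
  and finite_pins: "finite Q"
  using finite_subset[OF pins] by (auto simp: cell_def slots_def)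

lemma finite_pair_slots [simp]: "finite (pair_slots a j b l)"
  by (rule finite_subset[of _ "slots a j \<times> slots b l"]) (auto simp: pair_slots_def)

lemma cell_less: "i \<in> cell a \<Longrightarrow> i < n"
  and cell_part: "i \<in> cell a \<Longrightarrow> part i = a"
  and in_cell_part: "i < n \<Longrightarrow> i \<in> cell (part i)"
  by (auto simp: cell_def)

lemma pin_less: "(s, r) \<in> Q \<Longrightarrow> s < n" "(s, r) \<in> Q \<Longrightarrow> r < n"
  using pins by auto

lemma pin_unique: "(s, r) \<in> Q \<Longrightarrow> (s', r') \<in> Q \<Longrightarrow> s = s' \<longleftrightarrow> r = r'"
  using inj_onD[OF inj_fst, of "(s, r)" "(s', r')"] inj_onD[OF inj_snd, of "(s, r)" "(s', r')"] by auto

lemma sum_cells: "(\<Sum>a<q. \<Sum>i\<in>cell a. f i) = (\<Sum>i<n. f i)"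
  unfolding cell_def using part_less by (intro sum.group) auto

lemma aggregate_weighted_sum:
  "(\<Sum>a<q. \<Sum>j<n. \<Sum>b<q. \<Sum>l<n. f a j b l * aggregate F (a, j) (b, l)) =
   (\<Sum>i<n. \<Sum>j<n. \<Sum>k<n. \<Sum>l<n. f (part i) j (part k) l * F (i, j) (k, l))"
proof -
  have inner: "(\<Sum>b<q. \<Sum>l<n. f a j b l * aggregate F (a, j) (b, l)) =
      (\<Sum>i\<in>cell a. \<Sum>k<n. \<Sum>l<n. f (part i) j (part k) l * F (i, j) (k, l))" for a j
  proof -
    have "(\<Sum>b<q. \<Sum>l<n. f a j b l * aggregate F (a, j) (b, l)) =
       (\<Sum>b<q. \<Sum>l<n. \<Sum>i\<in>cell a. \<Sum>k\<in>cell b. f (part i) j (part k) l * F (i, j) (k, l))"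
      by (simp add: aggregate_apply sum_distrib_left cell_part)
    also have "\<dots> = (\<Sum>b<q. \<Sum>i\<in>cell a. \<Sum>l<n. \<Sum>k\<in>cell b. f (part i) j (part k) l * F (i, j) (k, l))"
      by (intro sum.cong refl sum.swap)
    also have "\<dots> = (\<Sum>b<q. \<Sum>i\<in>cell a. \<Sum>k\<in>cell b. \<Sum>l<n. f (part i) j (part k) l * F (i, j) (k, l))"
      by (intro sum.cong refl sum.swap)
    also have "\<dots> = (\<Sum>i\<in>cell a. \<Sum>b<q. \<Sum>k\<in>cell b. \<Sum>l<n. f (part i) j (part k) l * F (i, j) (k, l))"
      by (rule sum.swap)
    finally show ?thesis by (simp only: sum_cells)
  qed
  have "(\<Sum>a<q. \<Sum>j<n. \<Sum>i\<in>cell a. \<Sum>k<n. \<Sum>l<n. f (part i) j (part k) l * F (i, j) (k, l)) =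
    (\<Sum>a<q. \<Sum>i\<in>cell a. \<Sum>j<n. \<Sum>k<n. \<Sum>l<n. f (part i) j (part k) l * F (i, j) (k, l))"
    by (intro sum.cong refl sum.swap)
  then show ?thesis by (simp only: inner sum_cells)
qed

text \<open>
  A pin exhausts both the row and the column in which it lies, and unit capacities make distinct rows take distinct
  columns. A zero on the diagonal of a moment matrix kills its whole row.
\<close>
lemma moment_support:
  assumes F: "fine_moment F" and less: "i < n" "j < n" "k < n" "l < n" and nz: "F (i, j) (k, l) \<noteq> 0"
  shows "(i, k) \<in> pair_slots (part i) j (part k) l"
proof -
  have M: "assignment_moment n n (\<lambda>_. 1) F" and P: "\<And>s r. (s, r) \<in> Q \<Longrightarrow> F (s, r) (s, r) = 1"
    using F by (auto simp: fine_moment_def)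
  have c: "compat i j" if ij: "i < n" "j < n" "F (i, j) (i, j) \<noteq> 0" for i j
    unfolding compat_def
  proof (clarify)
    fix s r assume sr: "(s, r) \<in> Q"
    show "i = s \<longleftrightarrow> j = r"
      using moment_pin_other_row[OF M pin_less[OF sr] P[OF sr], of i]
        moment_pin_other_column[OF M pin_less[OF sr] P[OF sr], of j] ij by auto
  qed
  have "F (k, l) (i, j) \<noteq> 0" using moment_sym[OF M less] nz by simp
  then have "compat i j" "compat k l"
    using c moment_zero_row[OF M] less nz by blast+
  moreover have "i = k \<longleftrightarrow> j = l"
    using moment_same_column[OF M, of i k j] moment_same_row[OF M, of i j l] less nz by auto
  ultimately show ?thesis using less by (simp add: pair_slots_def slots_def in_cell_part)
qed

lemma aggregate_diag:
  assumes "\<And>i k. i \<in> cell a \<Longrightarrow> k \<in> cell a \<Longrightarrow> i \<noteq> k \<Longrightarrow> F (i, j) (k, j) = 0"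
  shows "aggregate F (a, j) (a, j) = (\<Sum>i\<in>cell a. F (i, j) (i, j))"
  unfolding aggregate_apply
proof (intro sum.cong refl)
  fix i assume i: "i \<in> cell a"
  show "(\<Sum>k\<in>cell a. F (i, j) (k, j)) = F (i, j) (i, j)"
    using assms i by (subst sum.remove[OF _ i]) auto
qed

text \<open>
  The form of the aggregate at \<open>x\<close> is the original form at \<open>x\<close> composed with \<open>part\<close>; all other conditions are
  obtained by summation over cells.
\<close>
lemma aggregate_moment:
  assumes F: "fine_moment F"
  shows "coarse_moment (aggregate F)"
proof -
  have M: "assignment_moment n n (\<lambda>_. 1) F" and P: "\<And>s r. (s, r) \<in> Q \<Longrightarrow> F (s, r) (s, r) = 1"
    using F by (auto simp: fine_moment_def)
  have diag: "aggregate F (a, j) (a, j) = (\<Sum>i\<in>cell a. F (i, j) (i, j))" if "j < n" for a j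
    using moment_same_column[OF M] that cell_less by (intro aggregate_diag) auto
  have sym: "aggregate F (a, j) (b, l) = aggregate F (b, l) (a, j)" if "j < n" "l < n" for a j b l
  proof -
    have "aggregate F (a, j) (b, l) = (\<Sum>k\<in>cell b. \<Sum>i\<in>cell a. F (i, j) (k, l))"
      unfolding aggregate_apply by (rule sum.swap)
    also have "\<dots> = aggregate F (b, l) (a, j)"
      unfolding aggregate_apply using that cell_less by (intro sum.cong refl moment_sym[OF M]) auto
    finally show ?thesis .
  qed
  have psd: "psd_on ({..<q} \<times> {..<n}) (aggregate F)"
    unfolding psd_on_def
  proof (intro conjI ballI allI)
    fix u v assume "u \<in> {..<q} \<times> {..<n}" "v \<in> {..<q} \<times> {..<n}"
    then show "aggregate F u v = aggregate F v u"
      using sym by auto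
  next
    fix x :: "nat \<times> nat \<Rightarrow> real"
    have "0 \<le> (\<Sum>u\<in>{..<n} \<times> {..<n}. \<Sum>v\<in>{..<n} \<times> {..<n}.
       x (part (fst u), snd u) * F u v * x (part (fst v), snd v))"
      by (rule psd_on_nonneg[OF moment_psd[OF M]])
    also have "\<dots> = (\<Sum>i<n. \<Sum>j<n. \<Sum>k<n. \<Sum>l<n. (x (part i, j) * x (part k, l)) * F (i, j) (k, l))"
      by (simp add: sum.cartesian_product' mult_ac)
    also have "\<dots> = (\<Sum>a<q. \<Sum>j<n. \<Sum>b<q. \<Sum>l<n. (x (a, j) * x (b, l)) * aggregate F (a, j) (b, l))"
      by (rule aggregate_weighted_sum[symmetric])
    also have "\<dots> = (\<Sum>u\<in>{..<q} \<times> {..<n}. \<Sum>v\<in>{..<q} \<times> {..<n}. x u * aggregate F u v * x v)"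
      by (simp add: sum.cartesian_product' mult_ac)
    finally show "0 \<le> (\<Sum>u\<in>{..<q} \<times> {..<n}. \<Sum>v\<in>{..<q} \<times> {..<n}. x u * aggregate F u v * x v)" .
  qed
  have nonneg: "0 \<le> aggregate F (a, j) (b, l)" if "j < n" "l < n" for a j b l
    unfolding aggregate_apply using that moment_nonneg[OF M] cell_less by (intro sum_nonneg) auto
  have column: "aggregate F (a, j) (b, j) = 0" if "j < n" "a \<noteq> b" for a b j
    unfolding aggregate_apply
  proof (intro sum.neutral ballI)
    fix i k assume "i \<in> cell a" "k \<in> cell b"
    then show "F (i, j) (k, j) = 0"
      using that by (intro moment_same_column[OF M]) (auto simp: cell_def)
  qed
  have row: "(\<Sum>l<n. aggregate F (a, j) (b, l)) = real (card (cell b)) * aggregate F (a, j) (a, j)"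
    if "j < n" for a j b
  proof -
    have "(\<Sum>l<n. aggregate F (a, j) (b, l)) = (\<Sum>i\<in>cell a. \<Sum>l<n. \<Sum>k\<in>cell b. F (i, j) (k, l))"
      unfolding aggregate_apply by (rule sum.swap)
    also have "\<dots> = (\<Sum>i\<in>cell a. \<Sum>k\<in>cell b. \<Sum>l<n. F (i, j) (k, l))"
      by (intro sum.cong refl sum.swap)
    also have "\<dots> = (\<Sum>i\<in>cell a. \<Sum>k\<in>cell b. F (i, j) (i, j))"
      using moment_row_sum[OF M] that cell_less by (intro sum.cong refl) auto
    finally show ?thesis by (simp add: diag[OF that] sum_distrib_left)
  qed
  have col: "(\<Sum>b<q. aggregate F (a, j) (b, l)) = aggregate F (a, j) (a, j)"
    if "j < n" "l < n" for a j l
  proof -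
    have "(\<Sum>b<q. aggregate F (a, j) (b, l)) = (\<Sum>i\<in>cell a. \<Sum>b<q. \<Sum>k\<in>cell b. F (i, j) (k, l))"
      unfolding aggregate_apply by (rule sum.swap)
    also have "\<dots> = (\<Sum>i\<in>cell a. F (i, j) (i, j))"
      unfolding sum_cells using moment_column_sum[OF M] that cell_less by (intro sum.cong refl) auto
    finally show ?thesis by (simp add: diag[OF that(1)])
  qed
  have row_marginal: "(\<Sum>j<n. aggregate F (a, j) (a, j)) = real (card (cell a))" for a
  proof -
    have "(\<Sum>j<n. aggregate F (a, j) (a, j)) = (\<Sum>j<n. \<Sum>i\<in>cell a. F (i, j) (i, j))"
      by (intro sum.cong refl) (simp add: diag)
    also have "\<dots> = (\<Sum>i\<in>cell a. \<Sum>j<n. F (i, j) (i, j))" by (rule sum.swap)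
    also have "\<dots> = real (card (cell a))"
      using moment_row_marginal[OF M] cell_less by simp
    finally show ?thesis .
  qed
  have column_marginal: "(\<Sum>a<q. aggregate F (a, j) (a, j)) = 1" if "j < n" for j
    using that by (simp add: diag sum_cells moment_column_marginal[OF M])
  have pin: "aggregate F (part s, r) (part s, r) = 1" if sr: "(s, r) \<in> Q" for s r
  proof -
    have "(\<Sum>i\<in>cell (part s) - {s}. F (i, r) (i, r)) = 0"
      using moment_pin_other_row[OF M pin_less[OF sr] P[OF sr]] cell_less by (intro sum.neutral) auto
    then show ?thesis
      using P[OF sr] by (simp add: diag pin_less[OF sr] sum.remove[OF _ in_cell_part[OF pin_less(1)[OF sr]]])
  qed
  have "\<forall>(s, r)\<in>Q. aggregate F (part s, r) (part s, r) = 1" using pin by blast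
  then show ?thesis unfolding coarse_moment_def assignment_moment_def
    using psd nonneg column row col row_marginal column_marginal by simp
qed

lemma slots_free_column: "j \<in> free_columns \<Longrightarrow> slots a j = free_rows a"
  by (force simp: slots_def compat_def free_rows_def free_columns_def)

lemma slots_pinned_column:
  assumes "(s, r) \<in> Q"
  shows "slots a r = (if part s = a then {s} else {})"
proof -
  have "compat i r \<longleftrightarrow> i = s" for i
    unfolding compat_def using assms pin_unique by fast
  then show ?thesis using pin_less[OF assms] by (auto simp: slots_def cell_def)
qed

text \<open>
  Only rows without a pin can be assigned to two different columns.
\<close>
lemma shared_slot_free:
  assumes "i \<in> slots a j" "i \<in> slots b l" "j < n" "l < n" "j \<noteq> l"
  shows "a = b \<and> j \<in> free_columns \<and> l \<in> free_columns"
  using assms by (force simp: slots_def cell_def compat_def free_columns_def)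

lemma pair_slots_diag: "pair_slots a j a j = (\<lambda>i. (i, i)) ` slots a j"
  by (auto simp: pair_slots_def)

lemma card_pair_slots_diag: "card (pair_slots a j a j) = card (slots a j)"
  unfolding pair_slots_diag by (intro card_image) (auto simp: inj_on_def)

lemma pair_slots_swap: "pair_slots b l a j = prod.swap ` pair_slots a j b l"
  by (auto simp: pair_slots_def)

lemma card_pair_slots_swap: "card (pair_slots b l a j) = card (pair_slots a j b l)"
  unfolding pair_slots_swap[of b l a j] by (rule card_image) simp

context
  fixes G
  assumes G: "coarse_moment G"
begin

lemma coarse: "assignment_moment q n (\<lambda>a. card (cell a)) G"
  and coarse_pin: "(s, r) \<in> Q \<Longrightarrow> G (part s, r) (part s, r) = 1"
  using G by (auto simp: coarse_moment_def)

lemma coarse_pin_column: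
  assumes sr: "(s, r) \<in> Q" and "a < q" "j < n" "b < q"
  shows "G (a, j) (b, r) = (if b = part s then G (a, j) (a, j) else 0)"
  using moment_pin_column[OF coarse part_less[OF pin_less(1)[OF sr]] pin_less(2)[OF sr] coarse_pin[OF sr]] assms
  by simp

lemma card_cell_eq: "card (cell a) = card (free_rows a) + card {p \<in> Q. part (fst p) = a}"
proof -
  have "cell a \<inter> fst ` Q = fst ` {p \<in> Q. part (fst p) = a}"
    using pins by (auto simp: cell_def)
  moreover have "card (fst ` {p \<in> Q. part (fst p) = a}) = card {p \<in> Q. part (fst p) = a}"
    by (rule card_image) (rule inj_on_subset[OF inj_fst], auto)
  moreover have "card (cell a) = card (cell a - fst ` Q) + card (cell a \<inter> fst ` Q)"
    using card_Int_Diff[of "cell a" "fst ` Q"] by simp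
  ultimately show ?thesis by (simp add: free_rows_def)
qed

lemma sum_columns: "(\<Sum>l<n. f l) = (\<Sum>l\<in>free_columns. f l) + (\<Sum>p\<in>Q. f (snd p))" for f :: "nat \<Rightarrow> real"
proof -
  have "snd ` Q \<subseteq> {..<n}" using pins by auto
  then have "(\<Sum>l<n. f l) = (\<Sum>l\<in>free_columns. f l) + (\<Sum>l\<in>snd ` Q. f l)"
    unfolding free_columns_def by (intro sum.subset_diff) auto
  then show ?thesis by (simp add: sum.reindex[OF inj_snd])
qed

text \<open>
  Each pin in part \<open>b\<close> removes one row of the part and contributes exactly one full diagonal entry to the row sum.
  So the pins can be deleted and the row sum condition survives on the free columns, with the number of free rows as
  capacity.
\<close>
lemma coarse_free_row_sum:
  assumes "a < q" "j < n" "b < q"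
  shows "(\<Sum>l\<in>free_columns. G (a, j) (b, l)) = real (card (free_rows b)) * G (a, j) (a, j)"
proof -
  have "(\<Sum>p\<in>Q. G (a, j) (b, snd p)) = (\<Sum>p\<in>Q. if part (fst p) = b then G (a, j) (a, j) else 0)"
    using coarse_pin_column[OF _ assms] by (intro sum.cong) auto
  also have "\<dots> = real (card {p \<in> Q. part (fst p) = b}) * G (a, j) (a, j)"
    using finite_pins by (simp add: sum.inter_filter[symmetric])
  finally show ?thesis
    using moment_row_sum[OF coarse assms] sum_columns[of "\<lambda>l. G (a, j) (b, l)"] card_cell_eq[of b]
    by (simp add: algebra_simps)
qed

lemma coarse_free_marginal:
  assumes a: "a < q"
  shows "(\<Sum>j\<in>free_columns. G (a, j) (a, j)) = real (card (free_rows a))"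
proof -
  have "(\<Sum>p\<in>Q. G (a, snd p) (a, snd p)) = (\<Sum>p\<in>Q. if part (fst p) = a then 1 else 0)"
  proof (intro sum.cong refl)
    fix p assume "p \<in> Q"
    then obtain s r where p: "p = (s, r)" and sr: "(s, r) \<in> Q" by (cases p) auto
    show "G (a, snd p) (a, snd p) = (if part (fst p) = a then 1 else 0)"
      using coarse_pin[OF sr] p moment_pin_other_row[OF coarse part_less[OF pin_less(1)[OF sr]]
        pin_less(2)[OF sr] coarse_pin[OF sr] a] by auto
  qed
  also have "\<dots> = real (card {p \<in> Q. part (fst p) = a})"
    using finite_pins by (simp add: sum.inter_filter[symmetric])
  finally show ?thesis
    using moment_row_marginal[OF coarse a] sum_columns[of "\<lambda>j. G (a, j) (a, j)"] card_cell_eq[of a] by simp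
qed

lemma free_columns_less: "j \<in> free_columns \<Longrightarrow> j < n"
  by (simp add: free_columns_def)

lemma coarse_zero_if_no_slot:
  assumes "a < q" "j < n" "slots a j = {}"
  shows "G (a, j) (a, j) = 0"
proof (cases "j \<in> free_columns")
  case True
  have "(\<Sum>l\<in>free_columns. G (a, j) (a, l)) = 0"
    using coarse_free_row_sum[of a j a] assms slots_free_column[OF True] by simp
  then show ?thesis
    using sum_nonneg_eq_0_iff[of free_columns "\<lambda>l. G (a, j) (a, l)"] True assms
      moment_nonneg[OF coarse] free_columns_less by (auto simp: free_columns_def)
next
  case False
  then obtain s where sr: "(s, j) \<in> Q" using assms by (auto simp: free_columns_def)
  then have "part s \<noteq> a" using slots_pinned_column[OF sr] assms by auto
  then show ?thesis
    using moment_pin_other_row[OF coarse part_less[OF pin_less(1)[OF sr]] assms(2) coarse_pin[OF sr] assms(1)] by simp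
qed

text \<open>
  In the case of distinct columns that both have slots, an empty set of pairs means that \<open>j\<close> and \<open>l\<close> compete for the only free row of one
  part. The diagonal entry then already exhausts the row sum over the free columns, and nonnegativity gives 0.
\<close>
lemma coarse_zero_if_no_pair_slot:
  assumes ab: "a < q" "j < n" "b < q" "l < n" and empty: "pair_slots a j b l = {}"
  shows "G (a, j) (b, l) = 0"
proof (cases "slots a j = {} \<or> slots b l = {}")
  case True
  then show ?thesis
    using coarse_zero_if_no_slot moment_zero_row[OF coarse] moment_sym[OF coarse ab] ab by metis
next
  case False
  then obtain i k where i: "i \<in> slots a j" and k: "k \<in> slots b l" by blast
  show ?thesis
  proof (cases "j = l")
    case True
    have "a \<noteq> b" using empty i True by (auto simp: pair_slots_diag)
    then show ?thesis using moment_same_column[OF coarse] ab True by simp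
  next
    case jl: False
    have all: "i' = k'" if "i' \<in> slots a j" "k' \<in> slots b l" for i' k'
      using empty that jl by (auto simp: pair_slots_def)
    have "a = b" and fr: "j \<in> free_columns" "l \<in> free_columns"
      using shared_slot_free[of i a j b l] i k all[OF i k] jl ab by auto
    then have "free_rows a = {i}" using all i slots_free_column by auto
    then have "(\<Sum>l\<in>free_columns. G (a, j) (a, l)) = G (a, j) (a, j)"
      using coarse_free_row_sum[of a j a] ab by simp
    then have "(\<Sum>l\<in>free_columns - {j}. G (a, j) (a, l)) = 0"
      using fr by (simp add: sum.remove[of _ j] free_columns_def)
    then show ?thesis
      using sum_nonneg_eq_0_iff[of "free_columns - {j}" "\<lambda>l. G (a, j) (a, l)"] fr ab jl \<open>a = b\<close>
        moment_nonneg[OF coarse] free_columns_less by (auto simp: free_columns_def)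
  qed
qed

text \<open>
  Spreading assigns the same value to all pairs of slots, so the weights enter only through their mean over these
  pairs.
\<close>
lemma aggregate_weighted_spread:
  assumes ab: "a < q" "j < n" "b < q" "l < n"
  shows "(\<Sum>i\<in>cell a. \<Sum>k\<in>cell b. w i k * spread G (i, j) (k, l)) =
    G (a, j) (b, l) * ((\<Sum>(i, k)\<in>pair_slots a j b l. w i k) / real (card (pair_slots a j b l)))"
proof -
  have "(\<Sum>i\<in>cell a. \<Sum>k\<in>cell b. w i k * spread G (i, j) (k, l)) =
    (\<Sum>i\<in>cell a. \<Sum>k\<in>cell b. if (i, k) \<in> pair_slots a j b l
        then w i k * (G (a, j) (b, l) / real (card (pair_slots a j b l))) else 0)"
    by (intro sum.cong refl) (simp add: spread_def cell_part)
  also have "\<dots> = (\<Sum>p\<in>cell a \<times> cell b. if p \<in> pair_slots a j b l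
        then w (fst p) (snd p) * (G (a, j) (b, l) / real (card (pair_slots a j b l))) else 0)"
    unfolding sum.cartesian_product' fst_conv snd_conv ..
  also have "\<dots> = (\<Sum>p\<in>{p \<in> cell a \<times> cell b. p \<in> pair_slots a j b l}.
       w (fst p) (snd p) * (G (a, j) (b, l) / real (card (pair_slots a j b l))))"
    by (rule sum.inter_filter[symmetric]) simp
  also have "{p \<in> cell a \<times> cell b. p \<in> pair_slots a j b l} = pair_slots a j b l"
    by (auto simp: pair_slots_def slots_def)
  finally show ?thesis
    by (simp add: case_prod_unfold sum_distrib_left sum_divide_distrib mult.commute)
qed

lemma aggregate_spread:
  assumes ab: "a < q" "j < n" "b < q" "l < n"
  shows "aggregate (spread G) (a, j) (b, l) = G (a, j) (b, l)"
proof -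
  have "aggregate (spread G) (a, j) (b, l) =
    G (a, j) (b, l) * (real (card (pair_slots a j b l)) / real (card (pair_slots a j b l)))"
    using aggregate_weighted_spread[OF ab, of "\<lambda>_ _. 1"] by (simp add: aggregate_apply case_prod_unfold)
  then show ?thesis using coarse_zero_if_no_pair_slot[OF ab] by (cases "pair_slots a j b l = {}") simp_all
qed

lemma spread_diag:
  "spread G (i, j) (i, j) = (if i \<in> slots (part i) j then G (part i, j) (part i, j) / real (card (slots (part i) j)) else 0)"
  unfolding spread_def by (auto simp: card_pair_slots_diag) (auto simp: pair_slots_diag)

text \<open>
  The comparison is with the form of \<open>G\<close> at the vector \<open>z\<close> of slot means of \<open>x\<close>. The two forms agree term by
  term wherever the two slots are chosen independently, because then the mean of the products is the product of the
  means. The remaining terms have both columns free and both rows in the same part, and there the within-part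
  inequality applies.
\<close>
lemma spread_psd: "psd_on ({..<n} \<times> {..<n}) (spread G)"
  unfolding psd_on_def
proof (intro conjI ballI allI)
  fix u v assume "u \<in> {..<n} \<times> {..<n}" "v \<in> {..<n} \<times> {..<n}"
  then obtain i j k l where uv: "u = (i, j)" "v = (k, l)" and less: "i < n" "j < n" "k < n" "l < n" by auto
  have "(i, k) \<in> pair_slots (part i) j (part k) l \<longleftrightarrow> (k, i) \<in> pair_slots (part k) l (part i) j"
    by (auto simp: pair_slots_def)
  then show "spread G u v = spread G v u"
    using moment_sym[OF coarse part_less[OF less(1)] less(2) part_less[OF less(3)] less(4)]
    by (simp add: uv spread_def card_pair_slots_swap[of "part k" l])
next
  fix x :: "nat \<times> nat \<Rightarrow> real"
  define T where "T a j b l = (\<Sum>(i, k)\<in>pair_slots a j b l. x (i, j) * x (k, l)) / real (card (pair_slots a j b l))"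
    for a j b l
  define z where "z a j = (\<Sum>i\<in>slots a j. x (i, j)) / real (card (slots a j))" for a j
  define D where "D a j b l = G (a, j) (b, l) * T a j b l - G (a, j) (b, l) * (z a j * z b l)" for a j b l
  let ?X = "\<lambda>u v. x u * spread G u v * x v"
  have form: "(\<Sum>u\<in>{..<n} \<times> {..<n}. \<Sum>v\<in>{..<n} \<times> {..<n}. ?X u v)
     = (\<Sum>a<q. \<Sum>j<n. \<Sum>b<q. \<Sum>l<n. G (a, j) (b, l) * T a j b l)"
  proof -
    have "(\<Sum>u\<in>{..<n} \<times> {..<n}. \<Sum>v\<in>{..<n} \<times> {..<n}. ?X u v)
       = (\<Sum>a<q. \<Sum>j<n. \<Sum>b<q. \<Sum>l<n. 1 * aggregate ?X (a, j) (b, l))"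
      unfolding aggregate_weighted_sum by (simp add: sum.cartesian_product')
    also have "\<dots> = (\<Sum>a<q. \<Sum>j<n. \<Sum>b<q. \<Sum>l<n. G (a, j) (b, l) * T a j b l)"
    proof (intro sum.cong refl)
      fix a j b l assume "a \<in> {..<q}" "j \<in> {..<n}" "b \<in> {..<q}" "l \<in> {..<n}"
      then show "1 * aggregate ?X (a, j) (b, l) = G (a, j) (b, l) * T a j b l"
        using aggregate_weighted_spread[of a j b l "\<lambda>i k. x (i, j) * x (k, l)"]
        by (simp add: aggregate_apply T_def mult_ac)
    qed
    finally show ?thesis .
  qed
  \<comment> \<open>Unless the part is the same and both columns are free, the entry vanishes or the pair slots form the
    full product of the slots.\<close>
  have D0: "D a j b l = 0"
    if ab: "a < q" "j < n" "b < q" "l < n" and nf: "\<not> (a = b \<and> j \<in> free_columns \<and> l \<in> free_columns)" for a j b l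
  proof (cases "a \<noteq> b \<and> j = l")
    case True
    then show ?thesis using moment_same_column[OF coarse] ab by (simp add: D_def)
  next
    case False
    have "i = k \<longleftrightarrow> j = l" if "i \<in> slots a j" "k \<in> slots b l" for i k
    proof (cases "j = l")
      case True
      with False nf have "a = b" "j \<notin> free_columns" by auto
      then obtain s where "(s, j) \<in> Q" using ab by (auto simp: free_columns_def)
      from slots_pinned_column[OF this] show ?thesis
        using that True \<open>a = b\<close> by (auto split: if_splits)
    next
      case jl: False
      then show ?thesis using shared_slot_free[of i a j b l] that ab nf by auto
    qed
    then have "pair_slots a j b l = slots a j \<times> slots b l" by (auto simp: pair_slots_def)
    then have "T a j b l = z a j * z b l"
      by (simp add: T_def z_def sum_product sum.cartesian_product card_cartesian_product)
    then show ?thesis by (simp add: D_def)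
  qed
  have "0 \<le> (\<Sum>a<q. \<Sum>j<n. \<Sum>b<q. \<Sum>l<n. D a j b l)"
  proof (rule sum_nonneg)
    fix a assume "a \<in> {..<q}"
    then have a: "a < q" by simp
    have "(\<Sum>j<n. \<Sum>b<q. \<Sum>l<n. D a j b l) = (\<Sum>j<n. \<Sum>l<n. D a j a l)"
    proof (rule sum.cong[OF refl])
      fix j assume "j \<in> {..<n}"
      then have "(\<Sum>b\<in>{..<q} - {a}. \<Sum>l<n. D a j b l) = 0"
        using D0 a by (intro sum.neutral ballI) auto
      then show "(\<Sum>b<q. \<Sum>l<n. D a j b l) = (\<Sum>l<n. D a j a l)"
        using a by (simp add: sum.remove[of "{..<q}" a])
    qed
    also have "\<dots> = (\<Sum>j<n. \<Sum>l\<in>free_columns. D a j a l)"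
      using D0 a by (intro sum.cong[OF refl, of "{..<n}"] sum.mono_neutral_right) (auto simp: free_columns_def)
    also have "\<dots> = (\<Sum>j\<in>free_columns. \<Sum>l\<in>free_columns. D a j a l)"
      using D0 a free_columns_less by (intro sum.mono_neutral_right) (auto simp: free_columns_def intro!: sum.neutral)
    also have "0 \<le> \<dots>"
    proof -
      have "(\<Sum>j\<in>free_columns. \<Sum>l\<in>free_columns. G (a, j) (a, l) *
          ((\<Sum>i\<in>free_rows a. x (i, j)) / card (free_rows a) * ((\<Sum>i\<in>free_rows a. x (i, l)) / card (free_rows a))))
        \<le> (\<Sum>j\<in>free_columns. \<Sum>l\<in>free_columns. G (a, j) (a, l) *
          ((\<Sum>(i, k)\<in>{(i, k). i \<in> free_rows a \<and> k \<in> free_rows a \<and> (i = k \<longleftrightarrow> j = l)}. x (i, j) * x (k, l))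
            / card {(i, k). i \<in> free_rows a \<and> k \<in> free_rows a \<and> (i = k \<longleftrightarrow> j = l)}))"
        using moment_sym[OF coarse] moment_nonneg[OF coarse] coarse_free_row_sum free_columns_less a
        by (intro within_part_form_ge_mean_form) (auto simp: free_columns_def free_rows_def)
      then show ?thesis
        by (simp add: D_def T_def z_def sum_subtractf pair_slots_def slots_free_column)
    qed
    finally show "0 \<le> (\<Sum>j<n. \<Sum>b<q. \<Sum>l<n. D a j b l)" .
  qed
  moreover have "0 \<le> (\<Sum>u\<in>{..<q} \<times> {..<n}. \<Sum>v\<in>{..<q} \<times> {..<n}. z (fst u) (snd u) * G u v * z (fst v) (snd v))"
    by (rule psd_on_nonneg[OF moment_psd[OF coarse]])
  then have "0 \<le> (\<Sum>a<q. \<Sum>j<n. \<Sum>b<q. \<Sum>l<n. G (a, j) (b, l) * (z a j * z b l))"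
    by (simp add: sum.cartesian_product' mult_ac)
  ultimately show "0 \<le> (\<Sum>u\<in>{..<n} \<times> {..<n}. \<Sum>v\<in>{..<n} \<times> {..<n}. ?X u v)"
    unfolding form by (simp add: D_def sum_subtractf)
qed

text \<open>
  The row and column sums of the spread matrix are forced by its total, which aggregation preserves, and by the
  diagonal sums.
\<close>
lemma spread_moment: "fine_moment (spread G)"
proof -
  have nonneg: "0 \<le> spread G (i, j) (k, l)" if "i < n" "j < n" "k < n" "l < n" for i j k l
    using moment_nonneg[OF coarse] part_less that by (simp add: spread_def)
  have pattern: "spread G (i, j) (k, l) = 0" if "(i = k) \<noteq> (j = l)" for i j k l
    using that by (auto simp: spread_def pair_slots_def)
  have column_marginal: "(\<Sum>i<n. spread G (i, j) (i, j)) = 1" if j: "j < n" for j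
  proof -
    have "(\<Sum>i<n. spread G (i, j) (i, j)) = (\<Sum>a<q. aggregate (spread G) (a, j) (a, j))"
      by (simp add: aggregate_diag pattern sum_cells)
    also have "\<dots> = (\<Sum>a<q. G (a, j) (a, j))" using aggregate_spread j by simp
    finally show ?thesis using moment_column_marginal[OF coarse j] by simp
  qed
  have pin: "spread G (s, r) (s, r) = 1" if "(s, r) \<in> Q" for s r
    using coarse_pin[OF that] slots_pinned_column[OF that] by (simp add: spread_diag)
  have row_marginal: "(\<Sum>j<n. spread G (i, j) (i, j)) = 1" if i: "i < n" for i
  proof (cases "i \<in> fst ` Q")
    case True
    then obtain r where ir: "(i, r) \<in> Q" by force
    have "spread G (i, j) (i, j) = 0" if "j \<noteq> r" for j
      using ir that by (auto simp: spread_diag slots_def compat_def)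
    then show ?thesis
      using pin[OF ir] pin_less[OF ir] by (simp add: sum.remove[of "{..<n}" r])
  next
    case False
    then have fi: "i \<in> free_rows (part i)" using i by (simp add: free_rows_def in_cell_part)
    have slot: "i \<in> slots (part i) j \<longleftrightarrow> j \<in> free_columns" if "j < n" for j
    proof
      assume "i \<in> slots (part i) j"
      then show "j \<in> free_columns" using False that
        by (force simp: slots_def compat_def free_columns_def)
    qed (use fi slots_free_column in auto)
    have "(\<Sum>j<n. spread G (i, j) (i, j)) = (\<Sum>j\<in>free_columns. spread G (i, j) (i, j))"
      using slot by (intro sum.mono_neutral_right) (auto simp: free_columns_def spread_diag)
    also have "\<dots> = (\<Sum>j\<in>free_columns. G (part i, j) (part i, j) / real (card (free_rows (part i))))"
      using fi by (intro sum.cong refl) (simp add: spread_diag slots_free_column)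
    also have "\<dots> = real (card (free_rows (part i))) / real (card (free_rows (part i)))"
      using coarse_free_marginal[OF part_less[OF i]] by (simp add: sum_divide_distrib[symmetric])
    also have "\<dots> = 1" using fi by (auto simp: free_rows_def)
    finally show ?thesis .
  qed
  have total: "(\<Sum>i<n. \<Sum>j<n. \<Sum>k<n. \<Sum>l<n. spread G (i, j) (k, l)) = real (n^2)"
  proof -
    have cells: "(\<Sum>a<q. real (card (cell a))) = real n"
      using sum_cells[of "\<lambda>_. 1 :: real"] by simp
    have "(\<Sum>i<n. \<Sum>j<n. \<Sum>k<n. \<Sum>l<n. spread G (i, j) (k, l)) =
       (\<Sum>a<q. \<Sum>j<n. \<Sum>b<q. \<Sum>l<n. aggregate (spread G) (a, j) (b, l))"
      using aggregate_weighted_sum[of "\<lambda>_ _ _ _. 1" "spread G"] by simp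
    also have "\<dots> = (\<Sum>a<q. \<Sum>j<n. \<Sum>b<q. \<Sum>l<n. G (a, j) (b, l))"
      using aggregate_spread by simp
    also have "\<dots> = (\<Sum>a<q. \<Sum>j<n. \<Sum>b<q. real (card (cell b)) * G (a, j) (a, j))"
      using moment_row_sum[OF coarse] by simp
    also have "\<dots> = (\<Sum>a<q. real n * real (card (cell a)))"
      using moment_row_marginal[OF coarse]
      by (simp add: sum_distrib_right[symmetric] sum_distrib_left[symmetric] cells)
    finally show ?thesis by (simp add: sum_distrib_left[symmetric] cells power2_eq_square)
  qed
  have "\<forall>(s, r)\<in>Q. spread G (s, r) (s, r) = 1" using pin by blast
  then show ?thesis
    unfolding fine_moment_def assignment_moment_iff_total
    using spread_psd nonneg column_marginal row_marginal pattern total by simp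
qed

end

lemma stabilizer_permutes: "\<sigma> \<in> stabilizer \<Longrightarrow> \<sigma> permutes {..<n}"
  and stabilizer_part: "\<sigma> \<in> stabilizer \<Longrightarrow> i < n \<Longrightarrow> part (\<sigma> i) = part i"
  and stabilizer_pin: "\<sigma> \<in> stabilizer \<Longrightarrow> (s, r) \<in> Q \<Longrightarrow> \<sigma> s = s"
  by (auto simp: stabilizer_def)

lemma stabilizer_less: "\<sigma> \<in> stabilizer \<Longrightarrow> i < n \<Longrightarrow> \<sigma> i < n"
  using permutes_in_image[OF stabilizer_permutes] by auto

lemma stabilizer_inj: "\<sigma> \<in> stabilizer \<Longrightarrow> \<sigma> i = \<sigma> k \<longleftrightarrow> i = k"
  using permutes_inj[OF stabilizer_permutes] by (auto simp: inj_eq)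

lemma finite_stabilizer: "finite stabilizer"
  by (rule finite_subset[OF _ finite_permutations[of "{..<n}"]]) (auto simp: stabilizer_def)

lemma id_in_stabilizer: "id \<in> stabilizer"
  by (auto simp: stabilizer_def permutes_id)

lemma stabilizer_comp:
  assumes "\<sigma> \<in> stabilizer" "\<tau> \<in> stabilizer"
  shows "\<sigma> \<circ> \<tau> \<in> stabilizer"
proof -
  have "\<sigma> \<circ> \<tau> permutes {..<n}"
    by (rule permutes_compose[OF stabilizer_permutes[OF assms(2)] stabilizer_permutes[OF assms(1)]])
  moreover have "part ((\<sigma> \<circ> \<tau>) i) = part i" if "i < n" for i
    using assms that by (simp add: stabilizer_part stabilizer_less)
  moreover have "(\<sigma> \<circ> \<tau>) s = s" if "(s, r) \<in> Q" for s r
    using assms that by (simp add: stabilizer_pin)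
  ultimately show ?thesis unfolding stabilizer_def by blast
qed

lemma stabilizer_inv: "\<sigma> \<in> stabilizer \<Longrightarrow> inv_into UNIV \<sigma> \<in> stabilizer"
proof -
  assume \<sigma>: "\<sigma> \<in> stabilizer"
  have p: "\<sigma> permutes {..<n}" by (rule stabilizer_permutes[OF \<sigma>])
  have "part (inv_into UNIV \<sigma> i) = part i" if "i < n" for i
    using stabilizer_part[OF \<sigma>, of "inv_into UNIV \<sigma> i"] that permutes_inverses[OF p]
      permutes_in_image[OF permutes_inv[OF p]] by simp
  moreover have "inv_into UNIV \<sigma> s = s" if "(s, r) \<in> Q" for s r
    using stabilizer_pin[OF \<sigma> that] permutes_inverses[OF p] by metis
  ultimately show ?thesis using permutes_inv[OF p] by (auto simp: stabilizer_def)
qed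

lemma bij_betw_stabilizer_comp:
  assumes "\<tau> \<in> stabilizer"
  shows "bij_betw (\<lambda>\<sigma>. \<sigma> \<circ> \<tau>) stabilizer stabilizer"
proof (rule bij_betw_byWitness[of _ "\<lambda>\<sigma>. \<sigma> \<circ> inv_into UNIV \<tau>"])
  note inverse = permutes_inv_o[OF stabilizer_permutes[OF assms]]
  show "\<forall>\<sigma>\<in>stabilizer. (\<sigma> \<circ> \<tau>) \<circ> inv_into UNIV \<tau> = \<sigma>"
    "\<forall>\<sigma>\<in>stabilizer. (\<sigma> \<circ> inv_into UNIV \<tau>) \<circ> \<tau> = \<sigma>"
    by (simp_all add: comp_assoc inverse)
qed (use assms stabilizer_comp stabilizer_inv in blast)+

lemma compat_stabilizer: "\<sigma> \<in> stabilizer \<Longrightarrow> compat (\<sigma> i) j \<longleftrightarrow> compat i j"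
proof -
  assume \<sigma>: "\<sigma> \<in> stabilizer"
  have "(case p of (s, r) \<Rightarrow> \<sigma> i = s \<longleftrightarrow> j = r) = (case p of (s, r) \<Rightarrow> i = s \<longleftrightarrow> j = r)"
    if "p \<in> Q" for p
    using stabilizer_pin[OF \<sigma>, of "fst p" "snd p"] stabilizer_inj[OF \<sigma>, of i "fst p"] that
    by (cases p) simp
  then show ?thesis unfolding compat_def by (rule ball_cong[OF refl])
qed

lemma slots_stabilizer: "\<sigma> \<in> stabilizer \<Longrightarrow> i < n \<Longrightarrow> \<sigma> i \<in> slots a j \<longleftrightarrow> i \<in> slots a j"
  by (simp add: slots_def compat_stabilizer cell_def stabilizer_less stabilizer_part)

lemma pair_slots_stabilizer:
  "\<sigma> \<in> stabilizer \<Longrightarrow> i < n \<Longrightarrow> k < n \<Longrightarrow> (\<sigma> i, \<sigma> k) \<in> pair_slots a j b l \<longleftrightarrow> (i, k) \<in> pair_slots a j b l"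
  by (simp add: pair_slots_def slots_stabilizer stabilizer_inj)

lemma spread_stabilizer:
  "\<sigma> \<in> stabilizer \<Longrightarrow> i < n \<Longrightarrow> k < n \<Longrightarrow> spread G (\<sigma> i, j) (\<sigma> k, l) = spread G (i, j) (k, l)"
  by (simp add: spread_def pair_slots_stabilizer stabilizer_part)

text \<open>
  Two slots for the same column are both pinned to it, and then equal, or both unpinned.
\<close>
lemma transpose_in_stabilizer:
  assumes "i \<in> slots a j" "i' \<in> slots a j"
  shows "transpose i i' \<in> stabilizer"
proof -
  have i: "i < n" "i' < n" "part i = a" "part i' = a" "compat i j" "compat i' j"
    using assms by (auto simp: slots_def cell_def)
  have "transpose i i' s = s" if "(s, r) \<in> Q" for s r
  proof -
    have "i = s \<longleftrightarrow> i' = s" using i that by (auto simp: compat_def)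
    then show ?thesis by (auto simp: transpose_def)
  qed
  moreover have "transpose i i' permutes {..<n}" using i by (intro permutes_swap_id) auto
  moreover have "part (transpose i i' k) = part k" for k using i by (auto simp: transpose_def)
  ultimately show ?thesis by (auto simp: stabilizer_def)
qed

text \<open>
  Moving \<open>i\<close> to its target first leaves a single transposition for \<open>k\<close>, and this one does not touch the target
  of \<open>i\<close> because the two members of a pair are equal in both pairs or in neither.
\<close>
lemma stabilizer_transitive:
  assumes ik: "(i, k) \<in> pair_slots a j b l" and ik': "(i', k') \<in> pair_slots a j b l"
  obtains \<tau> where "\<tau> \<in> stabilizer" "\<tau> i = i'" "\<tau> k = k'"
proof -
  let ?t = "transpose i i'"
  have t: "?t \<in> stabilizer" using ik ik' by (intro transpose_in_stabilizer[of _ a j]) (auto simp: pair_slots_def)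
  have "k < n" using ik by (auto simp: pair_slots_def slots_def cell_def)
  then have "?t k \<in> slots b l" using ik slots_stabilizer[OF t] by (auto simp: pair_slots_def)
  then have u: "transpose (?t k) k' \<in> stabilizer"
    using ik' by (intro transpose_in_stabilizer[of _ b l]) (auto simp: pair_slots_def)
  have "(transpose (?t k) k' \<circ> ?t) i = i'" "(transpose (?t k) k' \<circ> ?t) k = k'"
    using ik ik' by (auto simp: pair_slots_def transpose_def)
  with stabilizer_comp[OF u t] show ?thesis using that by blast
qed

text \<open>
  The stabilizer sum vanishes outside the pair slots and, by transitivity, is constant on them. Summing it over all pair slots
  gives one copy of the aggregate for each group element, which determines the constant.
\<close>
lemma stabilizer_average_eq_spread_aggregate:
  assumes F: "fine_moment F" and less: "i < n" "j < n" "k < n" "l < n"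
  shows "(\<Sum>\<sigma>\<in>stabilizer. F (\<sigma> i, j) (\<sigma> k, l)) / real (card stabilizer) = spread (aggregate F) (i, j) (k, l)"
proof -
  let ?O = "pair_slots (part i) j (part k) l"
  define H where "H i k = (\<Sum>\<sigma>\<in>stabilizer. F (\<sigma> i, j) (\<sigma> k, l))" for i k
  have supp: "F (\<sigma> i', j) (\<sigma> k', l) = 0"
    if "\<sigma> \<in> stabilizer" "i' < n" "k' < n" "(i', k') \<notin> pair_slots (part i') j (part k') l" for \<sigma> i' k'
    using moment_support[OF F, of "\<sigma> i'" j "\<sigma> k'" l] that less pair_slots_stabilizer[OF that(1-3)]
    by (auto simp: stabilizer_less stabilizer_part)
  show ?thesis
  proof (cases "(i, k) \<in> ?O")
    case False
    then show ?thesis using supp less by (simp add: spread_def)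
  next
    case True
    have const: "H i' k' = H i k" if "(i', k') \<in> ?O" for i' k'
    proof -
      obtain \<tau> where \<tau>: "\<tau> \<in> stabilizer" "\<tau> i = i'" "\<tau> k = k'"
        using stabilizer_transitive[OF True \<open>(i', k') \<in> ?O\<close>] by blast
      have "H i k = (\<Sum>\<sigma>\<in>stabilizer. F ((\<sigma> \<circ> \<tau>) i, j) ((\<sigma> \<circ> \<tau>) k, l))"
        unfolding H_def by (rule sum.reindex_bij_betw[OF bij_betw_stabilizer_comp[OF \<tau>(1)], symmetric])
      then show ?thesis by (simp add: H_def \<tau>)
    qed
    have "real (card ?O) * H i k = (\<Sum>(i', k')\<in>?O. H i' k')"
      using const by (simp add: case_prod_unfold)
    also have "\<dots> = (\<Sum>p\<in>cell (part i) \<times> cell (part k). H (fst p) (snd p))"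
      unfolding case_prod_unfold
    proof (rule sum.mono_neutral_left)
      show "\<forall>p\<in>cell (part i) \<times> cell (part k) - ?O. H (fst p) (snd p) = 0"
        unfolding H_def using supp cell_less cell_part by (intro ballI sum.neutral) force
    qed (auto simp: pair_slots_def slots_def)
    also have "\<dots> = (\<Sum>i'\<in>cell (part i). \<Sum>k'\<in>cell (part k). H i' k')"
      by (simp add: sum.cartesian_product')
    also have "\<dots> = (\<Sum>i'\<in>cell (part i). \<Sum>\<sigma>\<in>stabilizer. \<Sum>k'\<in>cell (part k). F (\<sigma> i', j) (\<sigma> k', l))"
      unfolding H_def by (intro sum.cong refl sum.swap)
    also have "\<dots> = (\<Sum>\<sigma>\<in>stabilizer. \<Sum>i'\<in>cell (part i). \<Sum>k'\<in>cell (part k). F (\<sigma> i', j) (\<sigma> k', l))"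
      by (rule sum.swap)
    also have "\<dots> = (\<Sum>\<sigma>\<in>stabilizer. aggregate F (part i, j) (part k, l))"
    proof (intro sum.cong refl)
      fix \<sigma> assume \<sigma>: "\<sigma> \<in> stabilizer"
      have bij: "bij_betw \<sigma> (cell a) (cell a)" for a
      proof (rule bij_betw_byWitness[of _ "inv_into UNIV \<sigma>"])
        note p = stabilizer_permutes[OF \<sigma>]
        show "\<forall>a\<in>cell a. inv_into UNIV \<sigma> (\<sigma> a) = a" "\<forall>a\<in>cell a. \<sigma> (inv_into UNIV \<sigma> a) = a"
          using permutes_inverses[OF p] by auto
        show "\<sigma> ` cell a \<subseteq> cell a" "inv_into UNIV \<sigma> ` cell a \<subseteq> cell a"
          using stabilizer_part stabilizer_less \<sigma> stabilizer_inv[OF \<sigma>] by (auto simp: cell_def)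
      qed
      have "(\<Sum>i'\<in>cell (part i). \<Sum>k'\<in>cell (part k). F (\<sigma> i', j) (\<sigma> k', l))
        = (\<Sum>i'\<in>cell (part i). \<Sum>k'\<in>cell (part k). F (\<sigma> i', j) (k', l))"
        by (intro sum.cong refl sum.reindex_bij_betw[OF bij])
      also have "\<dots> = aggregate F (part i, j) (part k, l)"
        unfolding aggregate_apply by (rule sum.reindex_bij_betw[OF bij])
      finally show "(\<Sum>i'\<in>cell (part i). \<Sum>k'\<in>cell (part k). F (\<sigma> i', j) (\<sigma> k', l)) = aggregate F (part i, j) (part k, l)" .
    qed
    finally have eq: "real (card ?O) * H i k = real (card stabilizer) * aggregate F (part i, j) (part k, l)" by simp
    have "card ?O > 0" "card stabilizer > 0"
      using True finite_stabilizer id_in_stabilizer by (auto simp: card_gt_0_iff)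
    then have "H i k / real (card stabilizer) = aggregate F (part i, j) (part k, l) / real (card ?O)"
      using eq by (subst frac_eq_eq) (auto simp: mult.commute)
    then show ?thesis using True by (simp add: spread_def H_def)
  qed
qed

end

section \<open>Block entries and the assignment program\<close>

text \<open>
  Row \<open>i * n + j\<close> of a matrix of blocks of order \<open>n\<close> is the pair of block \<open>i\<close> and position \<open>j\<close>, in agreement
  with the Kronecker product.
\<close>
definition entries :: "nat \<Rightarrow> real mat \<Rightarrow> nat \<times> nat \<Rightarrow> nat \<times> nat \<Rightarrow> real" where
  "entries n Y = (\<lambda>(i, j) (k, l). Y $$ (i * n + j, k * n + l))"

definition block_mat :: "nat \<Rightarrow> nat \<Rightarrow> (nat \<times> nat \<Rightarrow> nat \<times> nat \<Rightarrow> real) \<Rightarrow> real mat" where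
  "block_mat p n F = mat (p * n) (p * n) (\<lambda>(u, v). F (u div n, u mod n) (v div n, v mod n))"

definition diag_vec :: "real mat \<Rightarrow> real vec" where
  "diag_vec Y = vec (dim_row Y) (\<lambda>u. Y $$ (u, u))"

lemma entries_apply: "entries n Y (i, j) (k, l) = Y $$ (i * n + j, k * n + l)"
  by (simp add: entries_def)

lemma block_index_less:
  fixes i j n p :: nat
  assumes "i < p" "j < n"
  shows "i * n + j < p * n"
proof -
  have "i * n + j < (i + 1) * n" using assms by simp
  also have "\<dots> \<le> p * n" using assms by (intro mult_right_mono) auto
  finally show ?thesis .
qed

lemma block_index_bij: "bij_betw (\<lambda>(i, j). i * n + j) ({..<p} \<times> {..<n}) {..<p * n :: nat}"
proof (rule bij_betw_byWitness[of _ "\<lambda>u. (u div n, u mod n)"])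
  show "(\<lambda>(i, j). i * n + j) ` ({..<p} \<times> {..<n}) \<subseteq> {..<p * n}"
    using block_index_less by auto
  show "(\<lambda>u. (u div n, u mod n)) ` {..<p * n} \<subseteq> {..<p} \<times> {..<n}"
    by (cases "n = 0") (auto simp: less_mult_imp_div_less)
qed auto

lemma sum_block_index:
  fixes f :: "nat \<Rightarrow> real"
  shows "(\<Sum>u<p * n. f u) = (\<Sum>i<p. \<Sum>j<n. f (i * n + j))"
  using sum.reindex_bij_betw[OF block_index_bij, of f n p, symmetric]
  by (simp add: sum.cartesian_product' case_prod_unfold)

lemma block_mat_carrier [simp]: "block_mat p n F \<in> carrier_mat (p * n) (p * n)"
  by (simp add: block_mat_def)

lemma entries_block_mat [simp]:
  "i < p \<Longrightarrow> j < n \<Longrightarrow> k < p \<Longrightarrow> l < n \<Longrightarrow> entries n (block_mat p n F) (i, j) (k, l) = F (i, j) (k, l)"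
  using block_index_less by (simp add: entries_def block_mat_def)

lemma eq_block_mat:
  assumes Y: "Y \<in> carrier_mat (p * n) (p * n)"
    and eq: "\<And>i j k l. i < p \<Longrightarrow> j < n \<Longrightarrow> k < p \<Longrightarrow> l < n \<Longrightarrow> entries n Y (i, j) (k, l) = F (i, j) (k, l)"
  shows "Y = block_mat p n F"
proof (rule eq_matI)
  fix u v assume "u < dim_row (block_mat p n F)" "v < dim_col (block_mat p n F)"
  then have uv: "u < p * n" "v < p * n" by (auto simp: block_mat_def)
  then have "0 < n" by (cases n) auto
  then show "Y $$ (u, v) = block_mat p n F $$ (u, v)"
    using eq[of "u div n" "u mod n" "v div n" "v mod n"] uv
    by (simp add: block_mat_def entries_apply less_mult_imp_div_less)
qed (use Y in \<open>auto simp: block_mat_def\<close>)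

lemma trace_mult_blocks:
  assumes M: "M \<in> carrier_mat (p * n) (p * n)" and Y: "Y \<in> carrier_mat (p * n) (p * n)"
  shows "tr (M * Y) = (\<Sum>i<p. \<Sum>j<n. \<Sum>k<p. \<Sum>l<n. M $$ (k * n + l, i * n + j) * entries n Y (i, j) (k, l))"
proof -
  have "tr (M * Y) = (\<Sum>u<p * n. \<Sum>v<p * n. M $$ (u, v) * Y $$ (v, u))"
    using M Y by (simp add: tr_def scalar_prod_def atLeast0LessThan)
  also have "\<dots> = (\<Sum>v<p * n. \<Sum>u<p * n. M $$ (u, v) * Y $$ (v, u))"
    by (rule sum.swap)
  finally show ?thesis by (simp only: sum_block_index entries_apply)
qed

lemma kron_carrier:
  "A \<in> carrier_mat p p \<Longrightarrow> B \<in> carrier_mat n n \<Longrightarrow> A \<otimes>\<^sub>m B \<in> carrier_mat (p * n) (p * n)"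
  by (auto simp: kron_def)

lemma kron_index:
  assumes "A \<in> carrier_mat p p" "B \<in> carrier_mat n n" "i < p" "j < n" "k < p" "l < n"
  shows "(A \<otimes>\<^sub>m B) $$ (i * n + j, k * n + l) = A $$ (i, k) * B $$ (j, l)"
  using assms block_index_less by (auto simp: kron_def)

lemma psd_mats_iff: "Y \<in> psd_mats N \<longleftrightarrow> Y \<in> carrier_mat N N \<and> psd_on {..<N} (\<lambda>u v. Y $$ (u, v))"
proof (cases "Y \<in> carrier_mat N N")
  case True
  have form: "x \<bullet> (Y *\<^sub>v x) = (\<Sum>u<N. \<Sum>v<N. x $ u * Y $$ (u, v) * x $ v)" if "x \<in> carrier_vec N" for x
    using that True
    by (simp add: scalar_prod_def atLeast0LessThan sum_distrib_left mult.assoc)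
  have "transpose_mat Y = Y \<longleftrightarrow> (\<forall>u\<in>{..<N}. \<forall>v\<in>{..<N}. Y $$ (u, v) = Y $$ (v, u))"
  proof
    assume T: "transpose_mat Y = Y"
    have "Y $$ (u, v) = Y $$ (v, u)" if "u < N" "v < N" for u v
      using index_transpose_mat(1)[of u Y v] that True by (simp add: T)
    then show "\<forall>u\<in>{..<N}. \<forall>v\<in>{..<N}. Y $$ (u, v) = Y $$ (v, u)" by auto
  qed (use True in \<open>auto intro!: eq_matI\<close>)
  moreover have "(\<forall>x\<in>carrier_vec N. 0 \<le> x \<bullet> (Y *\<^sub>v x)) \<longleftrightarrow>
     (\<forall>x. 0 \<le> (\<Sum>u<N. \<Sum>v<N. x u * Y $$ (u, v) * x v))" (is "?L \<longleftrightarrow> ?R")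
  proof
    assume ?L
    show ?R
    proof
      fix x :: "nat \<Rightarrow> real"
      show "0 \<le> (\<Sum>u<N. \<Sum>v<N. x u * Y $$ (u, v) * x v)"
        using \<open>?L\<close>[rule_format, of "vec N x"] form[of "vec N x"] by simp
    qed
  qed (simp add: form)
  ultimately show ?thesis using True by (simp add: psd_mats_def psd_on_def)
qed (simp add: psd_mats_def)

lemma psd_mats_blocks:
  "Y \<in> psd_mats (p * n) \<longleftrightarrow> Y \<in> carrier_mat (p * n) (p * n) \<and> psd_on ({..<p} \<times> {..<n}) (entries n Y)"
  unfolding psd_mats_iff psd_on_reindex[OF block_index_bij] by (simp add: entries_def case_prod_unfold)

lemma nonneg_mat_blocks:
  assumes Y: "Y \<in> carrier_mat (p * n) (p * n)"
  shows "nonneg_mat Y \<longleftrightarrow> (\<forall>i<p. \<forall>j<n. \<forall>k<p. \<forall>l<n. 0 \<le> entries n Y (i, j) (k, l))"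
proof
  assume "nonneg_mat Y"
  then show "\<forall>i<p. \<forall>j<n. \<forall>k<p. \<forall>l<n. 0 \<le> entries n Y (i, j) (k, l)"
    using Y block_index_less by (auto simp: nonneg_mat_def entries_apply)
next
  assume R: "\<forall>i<p. \<forall>j<n. \<forall>k<p. \<forall>l<n. 0 \<le> entries n Y (i, j) (k, l)"
  show "nonneg_mat Y" unfolding nonneg_mat_def
  proof (intro allI impI)
    fix u v assume "u < dim_row Y" "v < dim_col Y"
    then have uv: "u < p * n" "v < p * n" using Y by auto
    then have "0 < n" by (cases n) auto
    then show "0 \<le> Y $$ (u, v)"
      using R[rule_format, of "u div n" "u mod n" "v div n" "v mod n"] uv
      by (simp add: entries_apply less_mult_imp_div_less)
  qed
qed

lemma sum_if_const: "(\<Sum>x\<in>A. if P then f x else 0) = (if P then \<Sum>x\<in>A. f x else 0)"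
  for f :: "'a \<Rightarrow> real"
  by simp

lemma E_mat_carrier [simp]: "E_mat k i j \<in> carrier_mat k k"
  by (simp add: E_mat_def)

lemma ones_mat_carrier [simp]: "ones_mat p q \<in> carrier_mat p q"
  by (simp add: ones_mat_def)

lemma off_diag_index: "i < n \<Longrightarrow> j < n \<Longrightarrow> (ones_mat n n - 1\<^sub>m n) $$ (i, j) = (if i = j then 0 else 1)"
  by (simp add: ones_mat_def)

lemma off_diag_carrier [simp]: "ones_mat n n - 1\<^sub>m n \<in> carrier_mat n n"
  by (rule minus_carrier_mat) simp

lemma trace_kron:
  assumes "A \<in> carrier_mat p p" "B \<in> carrier_mat n n" "Y \<in> carrier_mat (p * n) (p * n)"
  shows "tr ((A \<otimes>\<^sub>m B) * Y) =
    (\<Sum>i<p. \<Sum>j<n. \<Sum>k<p. \<Sum>l<n. A $$ (k, i) * B $$ (l, j) * entries n Y (i, j) (k, l))"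
  unfolding trace_mult_blocks[OF kron_carrier[OF assms(1,2)] assms(3)]
  using kron_index[OF assms(1,2)] by (intro sum.cong refl) simp

lemma trace_E_kron_E:
  assumes "Y \<in> carrier_mat (p * n) (p * n)" "a < p" "c < n"
  shows "tr ((E_mat p a a \<otimes>\<^sub>m E_mat n c c) * Y) = entries n Y (a, c) (a, c)"
proof -
  have "tr ((E_mat p a a \<otimes>\<^sub>m E_mat n c c) * Y) = (\<Sum>i<p. \<Sum>j<n. \<Sum>k<p. \<Sum>l<n.
      if i = a then if j = c then if k = a then if l = c then entries n Y (i, j) (k, l) else 0 else 0 else 0 else 0)"
    unfolding trace_kron[OF E_mat_carrier E_mat_carrier assms(1)]
    by (intro sum.cong refl) (simp add: E_mat_def)
  then show ?thesis using assms by (simp add: sum_if_const)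
qed

lemma trace_one_kron_E:
  assumes "Y \<in> carrier_mat (p * n) (p * n)" "c < n"
  shows "tr ((1\<^sub>m p \<otimes>\<^sub>m E_mat n c c) * Y) = (\<Sum>i<p. entries n Y (i, c) (i, c))"
proof -
  have "tr ((1\<^sub>m p \<otimes>\<^sub>m E_mat n c c) * Y) = (\<Sum>i<p. \<Sum>j<n. \<Sum>k<p. \<Sum>l<n.
      if j = c then if k = i then if l = c then entries n Y (i, j) (k, l) else 0 else 0 else 0)"
    unfolding trace_kron[OF one_carrier_mat E_mat_carrier assms(1)]
    by (intro sum.cong refl) (simp add: E_mat_def)
  then show ?thesis using assms by (simp add: sum_if_const)
qed

lemma trace_E_kron_one:
  assumes "Y \<in> carrier_mat (p * n) (p * n)" "a < p"
  shows "tr ((E_mat p a a \<otimes>\<^sub>m 1\<^sub>m n) * Y) = (\<Sum>j<n. entries n Y (a, j) (a, j))"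
proof -
  have "tr ((E_mat p a a \<otimes>\<^sub>m 1\<^sub>m n) * Y) = (\<Sum>i<p. \<Sum>j<n. \<Sum>k<p. \<Sum>l<n.
      if i = a then if k = a then if l = j then entries n Y (i, j) (k, l) else 0 else 0 else 0)"
    unfolding trace_kron[OF E_mat_carrier one_carrier_mat assms(1)]
    by (intro sum.cong refl) (simp add: E_mat_def)
  then show ?thesis using assms by (simp add: sum_if_const)
qed

lemma trace_one_kron_ones:
  assumes "Y \<in> carrier_mat (p * n) (p * n)"
  shows "tr ((1\<^sub>m p \<otimes>\<^sub>m ones_mat n n) * Y) = (\<Sum>i<p. \<Sum>j<n. \<Sum>l<n. entries n Y (i, j) (i, l))"
proof -
  have "tr ((1\<^sub>m p \<otimes>\<^sub>m ones_mat n n) * Y) = (\<Sum>i<p. \<Sum>j<n. \<Sum>k<p. \<Sum>l<n.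
      if k = i then entries n Y (i, j) (k, l) else 0)"
    unfolding trace_kron[OF one_carrier_mat ones_mat_carrier assms(1)]
    by (intro sum.cong refl) (simp add: ones_mat_def)
  then show ?thesis using assms by (simp add: sum_if_const)
qed

lemma trace_blocks:
  "Y \<in> carrier_mat (p * n) (p * n) \<Longrightarrow> tr Y = (\<Sum>i<p. \<Sum>j<n. entries n Y (i, j) (i, j))"
  by (auto simp: tr_def sum_block_index entries_apply)

lemma sum4_nonneg_eq_0_iff:
  fixes f :: "nat \<Rightarrow> nat \<Rightarrow> nat \<Rightarrow> nat \<Rightarrow> real"
  assumes "\<And>i j k l. i < p \<Longrightarrow> j < n \<Longrightarrow> k < p \<Longrightarrow> l < n \<Longrightarrow> 0 \<le> f i j k l"
  shows "(\<Sum>i<p. \<Sum>j<n. \<Sum>k<p. \<Sum>l<n. f i j k l) = 0 \<longleftrightarrow> (\<forall>i<p. \<forall>j<n. \<forall>k<p. \<forall>l<n. f i j k l = 0)"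
proof -
  have "(\<Sum>i<p. \<Sum>j<n. \<Sum>k<p. \<Sum>l<n. f i j k l) =
      (\<Sum>(i, j, k, l)\<in>{..<p} \<times> {..<n} \<times> {..<p} \<times> {..<n}. f i j k l)"
    by (simp add: sum.cartesian_product)
  also have "\<dots> = 0 \<longleftrightarrow> (\<forall>(i, j, k, l)\<in>{..<p} \<times> {..<n} \<times> {..<p} \<times> {..<n}. f i j k l = 0)"
    using assms by (subst sum_nonneg_eq_0_iff) auto
  finally show ?thesis by auto
qed

text \<open>
  Since all entries are nonnegative, the single off-pattern trace constraint makes every entry outside the pattern
  vanish.
\<close>
lemma QAP_feasible_iff:
  assumes less: "fst s < n" "snd s < n" "fst r < n" "snd r < n"
  shows "Y \<in> QAP_feasible n s r \<longleftrightarrow> Y \<in> carrier_mat (n * n) (n * n) \<and>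
    assignment_moment n n (\<lambda>_. 1) (entries n Y) \<and>
    entries n Y (fst s, fst r) (fst s, fst r) = 1 \<and> entries n Y (snd s, snd r) (snd s, snd r) = 1"
proof (cases "Y \<in> carrier_mat (n * n) (n * n)")
  case Y: True
  have total: "tr (ones_mat (n^2) (n^2) * Y) = (\<Sum>i<n. \<Sum>j<n. \<Sum>k<n. \<Sum>l<n. entries n Y (i, j) (k, l))"
    unfolding power2_eq_square trace_mult_blocks[OF ones_mat_carrier Y]
    by (intro sum.cong refl) (simp add: ones_mat_def block_index_less)
  let ?M = "1\<^sub>m n \<otimes>\<^sub>m (ones_mat n n - 1\<^sub>m n) + (ones_mat n n - 1\<^sub>m n) \<otimes>\<^sub>m 1\<^sub>m n"
  have off: "tr (?M * Y) = (\<Sum>i<n. \<Sum>j<n. \<Sum>k<n. \<Sum>l<n. if (i = k) \<noteq> (j = l) then entries n Y (i, j) (k, l) else 0)"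
  proof -
    have 1: "1\<^sub>m n \<otimes>\<^sub>m (ones_mat n n - 1\<^sub>m n) \<in> carrier_mat (n * n) (n * n)"
      and 2: "(ones_mat n n - 1\<^sub>m n) \<otimes>\<^sub>m 1\<^sub>m n \<in> carrier_mat (n * n) (n * n)"
      by (intro kron_carrier; simp)+
    have "?M $$ (k * n + l, i * n + j) = (if (i = k) \<noteq> (j = l) then 1 else 0)"
      if "i < n" "j < n" "k < n" "l < n" for i j k l
    proof -
      have "?M $$ (k * n + l, i * n + j) = (1\<^sub>m n \<otimes>\<^sub>m (ones_mat n n - 1\<^sub>m n)) $$ (k * n + l, i * n + j)
         + ((ones_mat n n - 1\<^sub>m n) \<otimes>\<^sub>m 1\<^sub>m n) $$ (k * n + l, i * n + j)"
        using 2 block_index_less that by (intro index_add_mat) auto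
      also have "\<dots> = (if k = i then 1 else 0) * (if l = j then 0 else 1) + (if k = i then 0 else 1) * (if l = j then 1 else 0)"
        using that
        by (simp only: kron_index[OF one_carrier_mat off_diag_carrier] kron_index[OF off_diag_carrier one_carrier_mat]
            off_diag_index index_one_mat)
      finally show ?thesis by auto
    qed
    then show ?thesis
      unfolding trace_mult_blocks[OF add_carrier_mat[OF 2] Y] by (intro sum.cong refl) simp
  qed
  show ?thesis
  proof (cases "\<forall>i<n. \<forall>j<n. \<forall>k<n. \<forall>l<n. 0 \<le> entries n Y (i, j) (k, l)")
    case True
    have "tr (?M * Y) = 0 \<longleftrightarrow> (\<forall>i<n. \<forall>j<n. \<forall>k<n. \<forall>l<n. (i = k) \<noteq> (j = l) \<longrightarrow> entries n Y (i, j) (k, l) = 0)"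
      unfolding off using True by (subst sum4_nonneg_eq_0_iff) auto
    then show ?thesis
      unfolding QAP_feasible_def assignment_moment_iff_total mem_Collect_eq total
      using Y True less
      by (auto simp: power2_eq_square psd_mats_blocks nonneg_mat_blocks[OF Y] trace_E_kron_E[OF Y]
          trace_one_kron_E[OF Y] trace_E_kron_one[OF Y])
  next
    case False
    then show ?thesis
      unfolding QAP_feasible_def assignment_moment_iff_total mem_Collect_eq nonneg_mat_blocks[OF Y] by blast
  qed
qed (simp add: QAP_feasible_def psd_mats_def power2_eq_square)

section \<open>The bordered partition program\<close>

text \<open>
  The border sits at the index \<open>None\<close>.
\<close>
definition bordered :: "('a \<Rightarrow> real) \<Rightarrow> ('a \<Rightarrow> 'a \<Rightarrow> real) \<Rightarrow> 'a option \<Rightarrow> 'a option \<Rightarrow> real" where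
  "bordered y G u v = (case u of
     None \<Rightarrow> (case v of None \<Rightarrow> 1 | Some b \<Rightarrow> y b)
   | Some a \<Rightarrow> (case v of None \<Rightarrow> y a | Some b \<Rightarrow> G a b))"

lemma sum_insert_None:
  fixes f :: "'a option \<Rightarrow> real"
  assumes "finite S"
  shows "(\<Sum>u\<in>insert None (Some ` S). f u) = f None + (\<Sum>a\<in>S. f (Some a))"
  using assms by (simp add: sum.reindex)

lemma bordered_form:
  assumes "finite S"
  shows "(\<Sum>u\<in>insert None (Some ` S). \<Sum>v\<in>insert None (Some ` S). x u * bordered y G u v * x v) =
    (x None)^2 + 2 * x None * (\<Sum>a\<in>S. x (Some a) * y a) +
    (\<Sum>a\<in>S. \<Sum>b\<in>S. x (Some a) * G a b * x (Some b))"
proof -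
  have "(\<Sum>a\<in>S. x (Some a) * y a * x None) = x None * (\<Sum>a\<in>S. x (Some a) * y a)"
    "(\<Sum>a\<in>S. x None * y a * x (Some a)) = x None * (\<Sum>a\<in>S. x (Some a) * y a)"
    unfolding sum_distrib_left by (intro sum.cong refl; simp only: mult_ac)+
  then show ?thesis
    unfolding sum_insert_None[OF assms] bordered_def option.case
    by (simp add: sum.distrib power2_eq_square)
qed

text \<open>
  The indicator \<open>w\<close> of any column satisfies \<open>G w = y\<close> and \<open>w \<bullet> G w = 1\<close>. So the bordered form at \<open>(t, h)\<close> is the
  form of \<open>G\<close> at \<open>h + t w\<close>.
\<close>
lemma moment_bordered_psd:
  assumes M: "assignment_moment p n m G" and n: "0 < n"
    and y: "\<And>i j. i < p \<Longrightarrow> j < n \<Longrightarrow> y (i, j) = G (i, j) (i, j)"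
  shows "psd_on (insert None (Some ` ({..<p} \<times> {..<n}))) (bordered y G)"
  unfolding psd_on_def
proof (intro conjI ballI allI)
  fix u v
  assume "u \<in> insert None (Some ` ({..<p} \<times> {..<n}))" "v \<in> insert None (Some ` ({..<p} \<times> {..<n}))"
  then show "bordered y G u v = bordered y G v u"
    using psd_on_sym[OF moment_psd[OF M]] by (auto simp: bordered_def)
next
  fix x :: "(nat \<times> nat) option \<Rightarrow> real"
  let ?S = "{..<p} \<times> {..<n}"
  define t where "t = x None"
  define w :: "nat \<times> nat \<Rightarrow> real" where "w = (\<lambda>(i, j). if j = 0 then 1 else 0)"
  define h where "h a = x (Some a)" for a
  have Gw: "(\<Sum>b\<in>?S. G a b * w b) = y a" if "a \<in> ?S" for a
  proof -
    obtain i j where a: "a = (i, j)" "i < p" "j < n" using \<open>a \<in> ?S\<close> by auto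
    have "(\<Sum>b\<in>?S. G a b * w b) = (\<Sum>k<p. \<Sum>l<n. if l = 0 then G a (k, l) else 0)"
      unfolding sum.cartesian_product' by (intro sum.cong refl) (simp add: w_def)
    also have "\<dots> = (\<Sum>k<p. G a (k, 0))" using n by simp
    finally show ?thesis using moment_column_sum[OF M a(2,3) n] a y by simp
  qed
  have wy: "(\<Sum>a\<in>?S. w a * y a) = 1"
  proof -
    have "(\<Sum>a\<in>?S. w a * y a) = (\<Sum>k<p. \<Sum>l<n. if l = 0 then y (k, l) else 0)"
      unfolding sum.cartesian_product' by (intro sum.cong refl) (simp add: w_def)
    also have "\<dots> = (\<Sum>k<p. G (k, 0) (k, 0))" using n y by simp
    finally show ?thesis using moment_column_marginal[OF M n] by simp
  qed
  have wG: "(\<Sum>a\<in>?S. \<Sum>b\<in>?S. w a * G a b * h b) = (\<Sum>b\<in>?S. h b * y b)"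
  proof -
    have "(\<Sum>a\<in>?S. \<Sum>b\<in>?S. w a * G a b * h b) = (\<Sum>b\<in>?S. \<Sum>a\<in>?S. w a * G a b * h b)"
      by (rule sum.swap)
    also have "\<dots> = (\<Sum>b\<in>?S. h b * (\<Sum>a\<in>?S. G b a * w a))"
      unfolding sum_distrib_left using psd_on_sym[OF moment_psd[OF M]]
      by (intro sum.cong refl) simp
    finally show ?thesis by (simp add: Gw)
  qed
  have "0 \<le> (\<Sum>a\<in>?S. \<Sum>b\<in>?S. (h a + t * w a) * G a b * (h b + t * w b))"
    by (rule psd_on_nonneg[OF moment_psd[OF M]])
  also have "\<dots> = (\<Sum>a\<in>?S. \<Sum>b\<in>?S. h a * G a b * h b) + t * (\<Sum>a\<in>?S. h a * (\<Sum>b\<in>?S. G a b * w b))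
     + t * (\<Sum>a\<in>?S. \<Sum>b\<in>?S. w a * G a b * h b) + t * t * (\<Sum>a\<in>?S. w a * (\<Sum>b\<in>?S. G a b * w b))"
    by (simp only: sum_distrib_left sum.distrib[symmetric]) (intro sum.cong refl; simp only: algebra_simps)
  also have "\<dots> = (\<Sum>a\<in>?S. \<Sum>b\<in>?S. h a * G a b * h b) + 2 * t * (\<Sum>a\<in>?S. h a * y a) + t^2"
    unfolding wG using Gw wy by (simp add: power2_eq_square)
  finally show "0 \<le> (\<Sum>u\<in>insert None (Some ` ?S). \<Sum>v\<in>insert None (Some ` ?S). x u * bordered y G u v * x v)"
    by (subst bordered_form) (simp_all add: t_def h_def)
qed

text \<open>
  The equation \<open>square\<close> says that the bordered form summed over the vectors \<open>row i\<close> and \<open>col j\<close> is 0; these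
  represent the affine equations "row \<open>i\<close> sums to \<open>m i\<close>" and "column \<open>j\<close> sums to 1". Each summand is nonnegative,
  so all of these vectors lie in the kernel of the bordered matrix, and reading off the coordinates of that statement
  gives every moment condition.
\<close>
lemma bordered_relaxation_moment:
  assumes psd: "psd_on (insert None (Some ` ({..<p} \<times> {..<n}))) (bordered y G)"
    and nonneg: "\<And>i j k l. i < p \<Longrightarrow> j < n \<Longrightarrow> k < p \<Longrightarrow> l < n \<Longrightarrow> 0 \<le> G (i, j) (k, l)"
    and column: "\<And>i k j. i < p \<Longrightarrow> k < p \<Longrightarrow> j < n \<Longrightarrow> i \<noteq> k \<Longrightarrow> G (i, j) (k, j) = 0"
    and square: "(\<Sum>i<p. \<Sum>j<n. \<Sum>l<n. G (i, j) (i, l)) + (\<Sum>i<p. \<Sum>j<n. G (i, j) (i, j)) =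
      - ((\<Sum>i<p. (real (m i))^2) + real n) + 2 * (\<Sum>i<p. \<Sum>j<n. y (i, j) * (real (m i) + 1))"
  shows "assignment_moment p n m G" "\<And>i j. i < p \<Longrightarrow> j < n \<Longrightarrow> y (i, j) = G (i, j) (i, j)"
proof -
  let ?S = "{..<p} \<times> {..<n}"
  let ?O = "insert None (Some ` ?S)"
  let ?form = "\<lambda>x. \<Sum>u\<in>?O. \<Sum>v\<in>?O. x u * bordered y G u v * x v"
  have sym: "G a b = G b a" if "a \<in> ?S" "b \<in> ?S" for a b
    using psd_on_sym[OF psd, of "Some a" "Some b"] that by (auto simp: bordered_def)
  define row :: "nat \<Rightarrow> (nat \<times> nat) option \<Rightarrow> real"
    where "row i u = (case u of None \<Rightarrow> - real (m i) | Some a \<Rightarrow> if fst a = i then 1 else 0)" for i u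
  define col :: "nat \<Rightarrow> (nat \<times> nat) option \<Rightarrow> real"
    where "col j u = (case u of None \<Rightarrow> - 1 | Some a \<Rightarrow> if snd a = j then 1 else 0)" for j u
  have row_dot: "(\<Sum>a\<in>?S. f a * row i (Some a)) = (\<Sum>j<n. f (i, j))" if "i < p" for i and f :: "nat \<times> nat \<Rightarrow> real"
  proof -
    have "(\<Sum>a\<in>?S. f a * row i (Some a)) = (\<Sum>k<p. \<Sum>j<n. if k = i then f (k, j) else 0)"
      unfolding sum.cartesian_product' by (intro sum.cong refl) (simp add: row_def)
    then show ?thesis using that by (simp add: sum_if_const)
  qed
  have col_dot: "(\<Sum>a\<in>?S. f a * col j (Some a)) = (\<Sum>i<p. f (i, j))" if "j < n" for j and f :: "nat \<times> nat \<Rightarrow> real"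
  proof -
    have "(\<Sum>a\<in>?S. f a * col j (Some a)) = (\<Sum>i<p. \<Sum>l<n. if l = j then f (i, l) else 0)"
      unfolding sum.cartesian_product' by (intro sum.cong refl) (simp add: col_def)
    then show ?thesis using that by simp
  qed
  have form: "?form x = (x None)^2 + 2 * x None * (\<Sum>a\<in>?S. y a * x (Some a)) +
      (\<Sum>a\<in>?S. (\<Sum>b\<in>?S. G a b * x (Some b)) * x (Some a))" for x
    by (subst bordered_form) (simp_all add: sum_distrib_left sum_distrib_right mult_ac)
  have row_form: "?form (row i) = (real (m i))^2 - 2 * real (m i) * (\<Sum>j<n. y (i, j)) + (\<Sum>j<n. \<Sum>l<n. G (i, j) (i, l))"
    if "i < p" for i
    unfolding form row_dot[OF that] by (simp add: row_def)
  have col_form: "?form (col j) = 1 - 2 * (\<Sum>i<p. y (i, j)) + (\<Sum>i<p. G (i, j) (i, j))" if "j < n" for j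
  proof -
    have "(\<Sum>k<p. G (i, j) (k, j)) = G (i, j) (i, j)" if "i < p" for i
      using column that \<open>j < n\<close> by (subst sum.remove[of _ i]) auto
    then show ?thesis unfolding form col_dot[OF that] by (simp add: col_def)
  qed
  have nn: "0 \<le> ?form x" for x by (rule psd_on_nonneg[OF psd])
  have "(\<Sum>i<p. ?form (row i)) + (\<Sum>j<n. ?form (col j)) =
     (\<Sum>i<p. (real (m i))^2 - 2 * real (m i) * (\<Sum>j<n. y (i, j)) + (\<Sum>j<n. \<Sum>l<n. G (i, j) (i, l)))
     + (\<Sum>j<n. 1 - 2 * (\<Sum>i<p. y (i, j)) + (\<Sum>i<p. G (i, j) (i, j)))"
    by (intro arg_cong2[of _ _ _ _ "(+)"] sum.cong refl row_form col_form) simp_all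
  also have "\<dots> = 0"
  proof -
    have "(\<Sum>j<n. \<Sum>i<p. y (i, j)) = (\<Sum>i<p. \<Sum>j<n. y (i, j))"
      "(\<Sum>j<n. \<Sum>i<p. G (i, j) (i, j)) = (\<Sum>i<p. \<Sum>j<n. G (i, j) (i, j))"
      by (rule sum.swap)+
    moreover have "(\<Sum>i<p. \<Sum>j<n. y (i, j) * (real (m i) + 1)) =
       (\<Sum>i<p. real (m i) * (\<Sum>j<n. y (i, j))) + (\<Sum>i<p. \<Sum>j<n. y (i, j))"
      by (simp add: sum_distrib_left sum.distrib algebra_simps)
    ultimately show ?thesis using square
      by (simp add: sum.distrib sum_subtractf sum_distrib_left[symmetric] mult.assoc)
  qed
  finally have sum0: "(\<Sum>i<p. ?form (row i)) + (\<Sum>j<n. ?form (col j)) = 0" .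
  have "0 \<le> (\<Sum>i<p. ?form (row i))" "0 \<le> (\<Sum>j<n. ?form (col j))"
    by (rule sum_nonneg, rule nn)+
  with sum0 have sums0: "(\<Sum>i<p. ?form (row i)) = 0" "(\<Sum>j<n. ?form (col j)) = 0"
    by linarith+
  have row0: "?form (row i) = 0" if "i < p" for i
    using sums0(1) that nn by (subst (asm) sum_nonneg_eq_0_iff) auto
  have col0: "?form (col j) = 0" if "j < n" for j
    using sums0(2) that nn by (subst (asm) sum_nonneg_eq_0_iff) auto
  have rowk: "(\<Sum>v\<in>?O. bordered y G u v * row i v) = 0" if "i < p" "u \<in> ?O" for i u
    by (rule psd_on_kernel[OF psd _ row0[OF that(1)] that(2)]) simp
  have colk: "(\<Sum>v\<in>?O. bordered y G u v * col j v) = 0" if "j < n" "u \<in> ?O" for j u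
    by (rule psd_on_kernel[OF psd _ col0[OF that(1)] that(2)]) simp
  \<comment> \<open>The border row of the kernel equations gives the sums of \<open>y\<close>, the other rows those of \<open>G\<close>.\<close>
  have ker: "(\<Sum>v\<in>?O. bordered y G None v * x v) = x None + (\<Sum>a\<in>?S. y a * x (Some a))"
    "(\<Sum>v\<in>?O. bordered y G (Some a) v * x v) = y a * x None + (\<Sum>b\<in>?S. G a b * x (Some b))" for x a
    by (subst sum_insert_None; simp add: bordered_def)+
  have row_y: "(\<Sum>j<n. y (i, j)) = real (m i)" if "i < p" for i
    using rowk[OF that, of None] unfolding ker row_dot[OF that] by (simp add: row_def)
  have row_G: "(\<Sum>l<n. G a (i, l)) = real (m i) * y a" if "i < p" "a \<in> ?S" for i a
    using rowk[OF that(1), of "Some a"] that(2) unfolding ker row_dot[OF that(1)] by (simp add: row_def)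
  have col_y: "(\<Sum>i<p. y (i, j)) = 1" if "j < n" for j
    using colk[OF that, of None] unfolding ker col_dot[OF that] by (simp add: col_def)
  have col_G: "(\<Sum>i<p. G a (i, j)) = y a" if "j < n" "a \<in> ?S" for j a
    using colk[OF that(1), of "Some a"] that(2) unfolding ker col_dot[OF that(1)] by (simp add: col_def)
  have diag: "y (i, j) = G (i, j) (i, j)" if "i < p" "j < n" for i j
  proof -
    have "y (i, j) = (\<Sum>k<p. G (i, j) (k, j))" using col_G[of j "(i, j)"] that by simp
    also have "\<dots> = G (i, j) (i, j)"
      using column that by (subst sum.remove[of _ i]) auto
    finally show ?thesis .
  qed
  have "psd_on ?S G" unfolding psd_on_def
  proof (intro conjI ballI allI)
    fix x :: "nat \<times> nat \<Rightarrow> real"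
    show "0 \<le> (\<Sum>a\<in>?S. \<Sum>b\<in>?S. x a * G a b * x b)"
      using nn[of "\<lambda>u. case u of None \<Rightarrow> 0 | Some a \<Rightarrow> x a"] by (subst (asm) bordered_form) simp_all
  qed (rule sym)
  moreover have "(\<Sum>l<n. G (i, j) (k, l)) = real (m k) * G (i, j) (i, j)" if "i < p" "j < n" "k < p" for i j k
    using row_G[of k "(i, j)"] diag that by simp
  moreover have "(\<Sum>k<p. G (i, j) (k, l)) = G (i, j) (i, j)" if "i < p" "j < n" "l < n" for i j l
    using col_G[of l "(i, j)"] diag that by simp
  moreover have "(\<Sum>j<n. G (i, j) (i, j)) = real (m i)" if "i < p" for i
    using row_y[OF that] diag that by simp
  moreover have "(\<Sum>i<p. G (i, j) (i, j)) = 1" if "j < n" for j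
    using col_y[OF that] diag that by simp
  ultimately show "assignment_moment p n m G"
    unfolding assignment_moment_def using nonneg column by simp
  show "\<And>i j. i < p \<Longrightarrow> j < n \<Longrightarrow> y (i, j) = G (i, j) (i, j)" by (rule diag)
qed

lemma moment_square_identity:
  assumes M: "assignment_moment p n m G"
  shows "(\<Sum>i<p. \<Sum>j<n. \<Sum>l<n. G (i, j) (i, l)) + (\<Sum>i<p. \<Sum>j<n. G (i, j) (i, j)) =
      - ((\<Sum>i<p. (real (m i))^2) + real n) + 2 * (\<Sum>i<p. \<Sum>j<n. G (i, j) (i, j) * (real (m i) + 1))"
proof -
  have "(\<Sum>i<p. \<Sum>j<n. \<Sum>l<n. G (i, j) (i, l)) = (\<Sum>i<p. real (m i) * (\<Sum>j<n. G (i, j) (i, j)))"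
    using moment_row_sum[OF M] by (simp add: sum_distrib_left)
  also have "\<dots> = (\<Sum>i<p. (real (m i))^2)"
    using moment_row_marginal[OF M] by (simp add: power2_eq_square)
  finally have 1: "(\<Sum>i<p. \<Sum>j<n. \<Sum>l<n. G (i, j) (i, l)) = (\<Sum>i<p. (real (m i))^2)" .
  have "(\<Sum>i<p. \<Sum>j<n. G (i, j) (i, j)) = (\<Sum>j<n. \<Sum>i<p. G (i, j) (i, j))" by (rule sum.swap)
  also have "\<dots> = real n" using moment_column_marginal[OF M] by simp
  finally have 2: "(\<Sum>i<p. \<Sum>j<n. G (i, j) (i, j)) = real n" .
  have 3: "(\<Sum>i<p. real (m i)) = real n" using 2 moment_row_marginal[OF M] by simp
  have "(\<Sum>i<p. \<Sum>j<n. G (i, j) (i, j) * (real (m i) + 1)) = (\<Sum>i<p. real (m i) * (real (m i) + 1))"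
    using moment_row_marginal[OF M] by (simp add: sum_distrib_right[symmetric])
  also have "\<dots> = (\<Sum>i<p. (real (m i))^2) + real n"
    using 3 by (simp add: power2_eq_square sum.distrib distrib_left)
  finally show ?thesis using 1 2 by simp
qed

lemma bordered_mat_psd_iff:
  assumes Y: "Y \<in> carrier_mat (p * n) (p * n)" and y: "y \<in> carrier_vec (p * n)"
  shows "bordered_mat Y y \<in> psd_mats (p * n + 1) \<longleftrightarrow>
    psd_on (insert None (Some ` ({..<p} \<times> {..<n}))) (bordered (\<lambda>(i, j). y $ (i * n + j)) (entries n Y))"
proof -
  let ?B = "bordered_mat Y y"
  let ?O = "insert None (Some ` ({..<p} \<times> {..<n}))"
  define h where "h u = (case u of None \<Rightarrow> 0 | Some (i, j) \<Rightarrow> Suc (i * n + j))" for u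
  have carr: "?B \<in> carrier_mat (p * n + 1) (p * n + 1)"
    using Y y unfolding bordered_mat_def
    by (intro carrier_matI) (simp_all add: carrier_matD[OF Y] mat_of_rows_def mat_of_cols_def)
  have h: "bij_betw h ?O {..<p * n + 1}"
  proof (rule bij_betw_byWitness[of _ "\<lambda>w. if w = 0 then None else Some ((w - 1) div n, (w - 1) mod n)"])
    show "\<forall>u\<in>?O. (if h u = 0 then None else Some ((h u - 1) div n, (h u - 1) mod n)) = u"
      by (auto simp: h_def)
    show "\<forall>w\<in>{..<p * n + 1}. h (if w = 0 then None else Some ((w - 1) div n, (w - 1) mod n)) = w"
      by (auto simp: h_def)
    show "h ` ?O \<subseteq> {..<p * n + 1}" using block_index_less by (auto simp: h_def)
    show "(\<lambda>w. if w = 0 then None else Some ((w - 1) div n, (w - 1) mod n)) ` {..<p * n + 1} \<subseteq> ?O"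
      by (cases "n = 0") (auto simp: less_mult_imp_div_less image_iff)
  qed
  have "?B $$ (h u, h v) = bordered (\<lambda>(i, j). y $ (i * n + j)) (entries n Y) u v" if "u \<in> ?O" "v \<in> ?O" for u v
  proof -
    have "h u < p * n + 1" "h v < p * n + 1" using bij_betwE[OF h] that by auto
    then show ?thesis
      using that Y y unfolding bordered_mat_def
      by (auto simp: h_def bordered_def entries_apply mat_of_rows_def mat_of_cols_def split: option.splits)
  qed
  then have "psd_on ?O (\<lambda>u v. ?B $$ (h u, h v)) \<longleftrightarrow>
    psd_on ?O (bordered (\<lambda>(i, j). y $ (i * n + j)) (entries n Y))"
    unfolding psd_on_def by (simp cong: sum.cong)
  then show ?thesis using carr unfolding psd_mats_iff psd_on_reindex[OF h] by simp
qed

text \<open>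
  The bordering vector carries no freedom, so a feasible pair is determined by its matrix.
\<close>
lemma GPP_feasible_iff:
  assumes less: "fst r < n" "snd r < n"
  shows "(Y, y) \<in> GPP_feasible n m1 m2 m3 r \<longleftrightarrow> Y \<in> carrier_mat (3 * n) (3 * n) \<and> y = diag_vec Y \<and>
    assignment_moment 3 n (\<lambda>a. [m1, m2, m3] ! a) (entries n Y) \<and>
    entries n Y (0, fst r) (0, fst r) = 1 \<and> entries n Y (1, snd r) (1, snd r) = 1"
    (is "?L \<longleftrightarrow> ?R")
proof -
  let ?m = "\<lambda>a. [m1, m2, m3] ! a"
  let ?y = "\<lambda>(i, j). y $ (i * n + j)"
  have n: "0 < n" using less by simp
  have three: "{..<3::nat} = {0, 1, 2}" by auto
  have sizes: "real (m1^2 + m2^2 + m3^2) = (\<Sum>a<3. (real (?m a))^2)"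
    by (simp add: three)
  have off: "tr (((ones_mat 3 3 - 1\<^sub>m 3) \<otimes>\<^sub>m 1\<^sub>m n) * Y) =
     (\<Sum>i<3. \<Sum>j<n. \<Sum>k<3. \<Sum>l<n. if i \<noteq> k \<and> j = l then entries n Y (i, j) (k, l) else 0)"
    if Y: "Y \<in> carrier_mat (3 * n) (3 * n)"
    unfolding trace_kron[OF off_diag_carrier one_carrier_mat Y]
    by (intro sum.cong refl) (simp add: ones_mat_def)
  have weight: "y \<bullet> ((vec_of_list [real m1, real m2, real m3] + ones_vec 3) \<otimes>\<^sub>v ones_vec n) =
      (\<Sum>i<3. \<Sum>j<n. ?y (i, j) * (real (?m i) + 1))"
    if y: "y \<in> carrier_vec (3 * n)"
  proof -
    let ?c = "vec_of_list [real m1, real m2, real m3] + ones_vec 3"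
    have "(?c \<otimes>\<^sub>v ones_vec n) $ (i * n + j) = real (?m i) + 1" if "i < 3" "j < n" for i j
    proof -
      have "(?c \<otimes>\<^sub>v ones_vec n) $ (i * n + j) = ?c $ i"
        using that block_index_less[OF that] by (simp add: kron_vec_def ones_vec_def)
      also have "\<dots> = real (?m i) + 1"
        using that by (auto simp: ones_vec_def numeral_3_eq_3 less_Suc_eq)
      finally show ?thesis .
    qed
    note c = this
    have "y \<bullet> ((vec_of_list [real m1, real m2, real m3] + ones_vec 3) \<otimes>\<^sub>v ones_vec n) =
       (\<Sum>u<3 * n. y $ u * (((vec_of_list [real m1, real m2, real m3] + ones_vec 3) \<otimes>\<^sub>v ones_vec n) $ u))"
      using y by (simp add: scalar_prod_def kron_vec_def ones_vec_def atLeast0LessThan)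
    also have "\<dots> = (\<Sum>i<3. \<Sum>j<n. ?y (i, j) * (real (?m i) + 1))"
      unfolding sum_block_index
      by (intro sum.cong refl) (simp only: c lessThan_iff prod.case)
    finally show ?thesis .
  qed
  have constraint: "tr (((ones_mat 3 3 - 1\<^sub>m 3) \<otimes>\<^sub>m 1\<^sub>m n) * Y) = 0 \<longleftrightarrow>
     (\<forall>i<3. \<forall>k<3. \<forall>j<n. i \<noteq> k \<longrightarrow> entries n Y (i, j) (k, j) = 0)"
    if Y: "Y \<in> carrier_mat (3 * n) (3 * n)" and nonneg: "nonneg_mat Y"
    unfolding off[OF Y] using nonneg[unfolded nonneg_mat_blocks[OF Y]]
    by (subst sum4_nonneg_eq_0_iff) auto
  show ?thesis
  proof
    assume ?L
    then have Y: "Y \<in> carrier_mat (3 * n) (3 * n)" and y: "y \<in> carrier_vec (3 * n)"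
      and c0: "tr (((ones_mat 3 3 - 1\<^sub>m 3) \<otimes>\<^sub>m 1\<^sub>m n) * Y) = 0"
      and c: "tr ((1\<^sub>m 3 \<otimes>\<^sub>m ones_mat n n) * Y) + tr Y =
       - (real (m1^2 + m2^2 + m3^2) + real n) +
       2 * (y \<bullet> ((vec_of_list [real m1, real m2, real m3] + ones_vec 3) \<otimes>\<^sub>v ones_vec n))"
      and p0: "tr ((E_mat 3 0 0 \<otimes>\<^sub>m E_mat n (fst r) (fst r)) * Y) = 1"
      and p1: "tr ((E_mat 3 1 1 \<otimes>\<^sub>m E_mat n (snd r) (snd r)) * Y) = 1"
      and psd: "bordered_mat Y y \<in> psd_mats (3 * n + 1)" and nonneg: "nonneg_mat Y"
      unfolding GPP_feasible_def by auto
    note bordered = psd[unfolded bordered_mat_psd_iff[OF Y y]]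
    have nn: "0 \<le> entries n Y (i, j) (k, l)" if "i < 3" "j < n" "k < 3" "l < n" for i j k l
      using nonneg[unfolded nonneg_mat_blocks[OF Y]] that by blast
    have column: "entries n Y (i, j) (k, j) = 0" if "i < 3" "k < 3" "j < n" "i \<noteq> k" for i j k
      using c0[unfolded constraint[OF Y nonneg]] that by blast
    note square = c[unfolded trace_one_kron_ones[OF Y] trace_blocks[OF Y] sizes weight[OF y]]
    have M: "assignment_moment 3 n ?m (entries n Y)"
      by (rule bordered_relaxation_moment(1)[OF bordered nn column square])
    have d: "?y (i, j) = entries n Y (i, j) (i, j)" if "i < 3" "j < n" for i j
      by (rule bordered_relaxation_moment(2)[OF bordered nn column square that])
    have "y = diag_vec Y"
    proof (rule eq_vecI)
      fix u assume "u < dim_vec (diag_vec Y)"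
      then have u: "u < 3 * n" using Y by (simp add: diag_vec_def)
      then show "y $ u = diag_vec Y $ u"
        using d[of "u div n" "u mod n"] Y n by (simp add: diag_vec_def entries_apply less_mult_imp_div_less)
    qed (use Y y in \<open>auto simp: diag_vec_def\<close>)
    then show ?R
      using M Y p0 p1 trace_E_kron_E[OF Y _ less(1), of 0] trace_E_kron_E[OF Y _ less(2), of 1] by simp
  next
    assume R: ?R
    then have Y: "Y \<in> carrier_mat (3 * n) (3 * n)" and y: "y = diag_vec Y"
      and M: "assignment_moment 3 n ?m (entries n Y)" by auto
    have yc: "y \<in> carrier_vec (3 * n)" using y Y by (auto simp: diag_vec_def)
    have d: "?y (i, j) = entries n Y (i, j) (i, j)" if "i < 3" "j < n" for i j
      using Y block_index_less[OF that] by (simp add: y diag_vec_def entries_apply)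
    have nonneg: "nonneg_mat Y"
      unfolding nonneg_mat_blocks[OF Y] using moment_nonneg[OF M] by blast
    have B: "bordered_mat Y y \<in> psd_mats (3 * n + 1)"
      unfolding bordered_mat_psd_iff[OF Y yc] by (rule moment_bordered_psd[OF M n d])
    have "transpose_mat Y = Y"
      using moment_psd[OF M] Y psd_mats_blocks[of Y 3 n] by (simp add: psd_mats_def)
    moreover have "tr (((ones_mat 3 3 - 1\<^sub>m 3) \<otimes>\<^sub>m 1\<^sub>m n) * Y) = 0"
      unfolding constraint[OF Y nonneg] using moment_same_column[OF M] by blast
    moreover have "tr ((1\<^sub>m 3 \<otimes>\<^sub>m ones_mat n n) * Y) + tr Y =
       - (real (m1^2 + m2^2 + m3^2) + real n) +
       2 * (y \<bullet> ((vec_of_list [real m1, real m2, real m3] + ones_vec 3) \<otimes>\<^sub>v ones_vec n))"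
    proof -
      have "(\<Sum>i<3. \<Sum>j<n. ?y (i, j) * (real (?m i) + 1)) =
          (\<Sum>i<3. \<Sum>j<n. entries n Y (i, j) (i, j) * (real (?m i) + 1))"
        by (intro sum.cong refl) (simp only: d lessThan_iff)
      then show ?thesis
        unfolding trace_one_kron_ones[OF Y] trace_blocks[OF Y] sizes weight[OF yc]
        using moment_square_identity[OF M] by simp
    qed
    ultimately show ?L unfolding GPP_feasible_def
      using R Y yc B nonneg trace_E_kron_E[OF Y _ less(1), of 0] trace_E_kron_E[OF Y _ less(2), of 1]
      by simp
  qed
qed

section \<open>The stabilizer average of a matrix\<close>

lemma assignment_moment_cong_imp:
  assumes M: "assignment_moment p n m F"
    and F: "\<And>i j k l. i < p \<Longrightarrow> j < n \<Longrightarrow> k < p \<Longrightarrow> l < n \<Longrightarrow> F' (i, j) (k, l) = F (i, j) (k, l)"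
    and m: "\<And>i. i < p \<Longrightarrow> m' i = m i"
  shows "assignment_moment p n m' F'"
proof -
  have eq: "F' a b = F a b" if "a \<in> {..<p} \<times> {..<n}" "b \<in> {..<p} \<times> {..<n}" for a b
    using F that by auto
  have psd: "psd_on ({..<p} \<times> {..<n}) F'"
    using moment_psd[OF M] unfolding psd_on_def by (simp add: eq cong: sum.cong)
  have row: "(\<Sum>l<n. F' (i, j) (k, l)) = real (m' k) * F' (i, j) (i, j)" if "i < p" "j < n" "k < p" for i j k
    using moment_row_sum[OF M that] that by (simp add: F m)
  have column: "(\<Sum>k<p. F' (i, j) (k, l)) = F' (i, j) (i, j)" if "i < p" "j < n" "l < n" for i j l
    using moment_column_sum[OF M that] that by (simp add: F)
  have marginals: "(\<Sum>j<n. F' (i, j) (i, j)) = real (m' i)" if "i < p" for i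
    using moment_row_marginal[OF M that] that by (simp add: F m)
  have "(\<Sum>i<p. F' (i, j) (i, j)) = 1" if "j < n" for j
    using moment_column_marginal[OF M that] that by (simp add: F)
  with psd row column marginals show ?thesis
    unfolding assignment_moment_def
    using moment_nonneg[OF M] moment_same_column[OF M] by (simp add: F)
qed

lemma assignment_moment_cong:
  assumes "\<And>i j k l. i < p \<Longrightarrow> j < n \<Longrightarrow> k < p \<Longrightarrow> l < n \<Longrightarrow> F (i, j) (k, l) = F' (i, j) (k, l)"
    and "\<And>i. i < p \<Longrightarrow> m i = m' i"
  shows "assignment_moment p n m F \<longleftrightarrow> assignment_moment p n m' F'"
proof
  assume "assignment_moment p n m F"
  then show "assignment_moment p n m' F'"
    by (rule assignment_moment_cong_imp) (simp_all only: assms)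
next
  assume "assignment_moment p n m' F'"
  then show "assignment_moment p n m F"
    by (rule assignment_moment_cong_imp) (simp_all only: assms)
qed

lemma group_average_index:
  assumes "i < n" "j < n" "k < n" "l < n"
  shows "entries n (group_average n \<Gamma> Y) (i, j) (k, l) =
    (\<Sum>\<sigma>\<in>\<Gamma>. entries n Y (\<sigma> i, j) (\<sigma> k, l)) / real (card \<Gamma>)"
  using assms block_index_less[OF assms(1,2)] block_index_less[OF assms(3,4)]
  by (simp add: entries_apply group_average_def relabel_def power2_eq_square)

lemma group_average_carrier: "group_average n \<Gamma> Y \<in> carrier_mat (n * n) (n * n)"
  by (simp add: group_average_def power2_eq_square)

lemma group_average_of_invariant:
  assumes Y: "Y \<in> invariant_mats n \<Gamma>" and \<Gamma>: "finite \<Gamma>" "\<Gamma> \<noteq> {}"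
  shows "group_average n \<Gamma> Y = Y"
proof (rule eq_matI)
  fix u v assume "u < dim_row Y" "v < dim_col Y"
  then have "u < n^2" "v < n^2" using Y by (auto simp: invariant_mats_def)
  moreover have "(\<Sum>\<sigma>\<in>\<Gamma>. relabel n \<sigma> Y $$ (u, v)) = real (card \<Gamma>) * Y $$ (u, v)"
    using Y by (simp add: invariant_mats_def)
  ultimately show "group_average n \<Gamma> Y $$ (u, v) = Y $$ (u, v)"
    using \<Gamma> by (simp add: group_average_def)
qed (use Y in \<open>auto simp: group_average_def invariant_mats_def\<close>)

context pinned_partition
begin

definition coarsen :: "real mat \<Rightarrow> real mat" where
  "coarsen Y = block_mat q n (aggregate (entries n Y))"

definition refine_mat :: "real mat \<Rightarrow> real mat" where
  "refine_mat Z = block_mat n n (spread (entries n Z))"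

lemma aggregate_cong:
  assumes "\<And>i j k l. i < n \<Longrightarrow> j < n \<Longrightarrow> k < n \<Longrightarrow> l < n \<Longrightarrow> F (i, j) (k, l) = F' (i, j) (k, l)"
    and "j < n" "l < n"
  shows "aggregate F (a, j) (b, l) = aggregate F' (a, j) (b, l)"
  unfolding aggregate_apply using assms(2,3) by (intro sum.cong refl assms(1)) (auto dest: cell_less)

lemma coarsen_moment:
  assumes "fine_moment (entries n Y)"
  shows "coarse_moment (entries n (coarsen Y))"
proof -
  have "coarse_moment (aggregate (entries n Y))" by (rule aggregate_moment[OF assms])
  then show ?thesis
    unfolding coarse_moment_def coarsen_def
    using assignment_moment_cong[of q n "entries n (coarsen Y)" "aggregate (entries n Y)"] pin_less part_less
    by (auto simp: coarsen_def)
qed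

lemma refine_moment:
  assumes "coarse_moment (entries n Z)"
  shows "fine_moment (entries n (refine_mat Z))"
proof -
  have "fine_moment (spread (entries n Z))" by (rule spread_moment[OF assms])
  then show ?thesis
    unfolding fine_moment_def refine_mat_def
    using assignment_moment_cong[of n n "entries n (refine_mat Z)" "spread (entries n Z)"] pin_less
    by (auto simp: refine_mat_def)
qed

lemma coarsen_refine:
  assumes "coarse_moment (entries n Z)" and Z: "Z \<in> carrier_mat (q * n) (q * n)"
  shows "coarsen (refine_mat Z) = Z"
  unfolding coarsen_def
proof (rule eq_block_mat[OF Z, symmetric])
  fix a j b l assume less: "a < q" "j < n" "b < q" "l < n"
  have "aggregate (entries n (refine_mat Z)) (a, j) (b, l) = aggregate (spread (entries n Z)) (a, j) (b, l)"
    using less by (intro aggregate_cong) (simp_all add: refine_mat_def)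
  then show "entries n Z (a, j) (b, l) = aggregate (entries n (refine_mat Z)) (a, j) (b, l)"
    using aggregate_spread[OF assms(1) less] by simp
qed

lemma group_average_eq_refine_coarsen:
  assumes "fine_moment (entries n Y)"
  shows "group_average n stabilizer Y = refine_mat (coarsen Y)"
  unfolding refine_mat_def
proof (rule eq_block_mat[OF group_average_carrier])
  fix i j k l assume less: "i < n" "j < n" "k < n" "l < n"
  have "entries n (group_average n stabilizer Y) (i, j) (k, l) = spread (aggregate (entries n Y)) (i, j) (k, l)"
    unfolding group_average_index[OF less] by (rule stabilizer_average_eq_spread_aggregate[OF assms less])
  also have "\<dots> = spread (entries n (coarsen Y)) (i, j) (k, l)"
    using less part_less by (simp add: spread_def coarsen_def)
  finally show "entries n (group_average n stabilizer Y) (i, j) (k, l) = spread (entries n (coarsen Y)) (i, j) (k, l)" .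
qed

lemma refine_invariant: "refine_mat Z \<in> invariant_mats n stabilizer"
proof -
  have "relabel n \<sigma> (refine_mat Z) = refine_mat Z" if \<sigma>: "\<sigma> \<in> stabilizer" for \<sigma>
    unfolding refine_mat_def[of Z]
  proof (rule eq_block_mat)
    fix i j k l assume less: "i < n" "j < n" "k < n" "l < n"
    then show "entries n (relabel n \<sigma> (block_mat n n (spread (entries n Z)))) (i, j) (k, l)
        = spread (entries n Z) (i, j) (k, l)"
      using spread_stabilizer[OF \<sigma>] stabilizer_less[OF \<sigma>] block_index_less
        entries_block_mat[of "\<sigma> i" n j n "\<sigma> k" l "spread (entries n Z)"]
      by (simp add: entries_apply relabel_def power2_eq_square)
  qed (simp add: relabel_def power2_eq_square)
  then show ?thesis by (simp add: invariant_mats_def refine_mat_def power2_eq_square)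
qed

text \<open>
  The cost matrix \<open>B\<close> is constant on pairs of parts, so summing over the cells first does not change the cost.
\<close>
lemma coarsen_objective:
  assumes A: "A \<in> carrier_mat n n" and B: "B \<in> carrier_mat n n" and D: "D \<in> carrier_mat q q"
    and BD: "\<And>i k. i < n \<Longrightarrow> k < n \<Longrightarrow> B $$ (i, k) = D $$ (part i, part k)"
    and Y: "Y \<in> carrier_mat (n * n) (n * n)"
  shows "tr ((D \<otimes>\<^sub>m A) * coarsen Y) = tr ((B \<otimes>\<^sub>m A) * Y)"
proof -
  have "tr ((D \<otimes>\<^sub>m A) * coarsen Y) =
    (\<Sum>a<q. \<Sum>j<n. \<Sum>b<q. \<Sum>l<n. (D $$ (b, a) * A $$ (l, j)) * aggregate (entries n Y) (a, j) (b, l))"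
    unfolding coarsen_def trace_kron[OF D A block_mat_carrier] by (intro sum.cong refl) simp
  also have "\<dots> = (\<Sum>i<n. \<Sum>j<n. \<Sum>k<n. \<Sum>l<n. (D $$ (part k, part i) * A $$ (l, j)) * entries n Y (i, j) (k, l))"
    by (rule aggregate_weighted_sum)
  also have "\<dots> = tr ((B \<otimes>\<^sub>m A) * Y)"
    unfolding trace_kron[OF B A Y] by (intro sum.cong refl) (simp add: BD)
  finally show ?thesis .
qed

end

section \<open>The cut graph and the equivalence\<close>

definition cut_part :: "nat \<Rightarrow> nat \<Rightarrow> nat \<Rightarrow> nat" where
  "cut_part m1 m2 i = (if i < m1 then 0 else if i < m1 + m2 then 1 else 2)"

lemma cut_mat_carrier: "cut_mat m1 m2 m3 \<in> carrier_mat (m1 + m2 + m3) (m1 + m2 + m3)"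
  unfolding cut_mat_def by (intro four_block_carrier_mat zero_carrier_mat)

text \<open>
  Adjacency in the cut graph is the lift of the single edge between parts 0 and 1.
\<close>
lemma cut_mat_index:
  assumes "i < m1 + m2 + m3" "k < m1 + m2 + m3"
  shows "cut_mat m1 m2 m3 $$ (i, k) = (E_mat 3 0 1 + E_mat 3 1 0) $$ (cut_part m1 m2 i, cut_part m1 m2 k)"
proof -
  have "cut_mat m1 m2 m3 $$ (i, k) =
      (if i < m1 \<and> m1 \<le> k \<and> k < m1 + m2 \<or> m1 \<le> i \<and> i < m1 + m2 \<and> k < m1 then 1 else 0)"
    using assms by (simp add: cut_mat_def ones_mat_def)
  then show ?thesis by (simp add: E_mat_def cut_part_def)
qed

lemma cut_mat_adjacent:
  assumes "i < m1 + m2 + m3" "k < m1 + m2 + m3"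
  shows "cut_mat m1 m2 m3 $$ (i, k) = 1 \<longleftrightarrow>
    cut_part m1 m2 i = 0 \<and> cut_part m1 m2 k = 1 \<or> cut_part m1 m2 i = 1 \<and> cut_part m1 m2 k = 0"
proof -
  have "cut_part m1 m2 i < 3" "cut_part m1 m2 k < 3" by (simp_all add: cut_part_def)
  then show ?thesis unfolding cut_mat_index[OF assms] by (simp add: E_mat_def)
qed

lemma card_cut_part:
  assumes "m1 + m2 + m3 = n" "a < 3"
  shows "card {i \<in> {..<n}. cut_part m1 m2 i = a} = [m1, m2, m3] ! a"
proof -
  have cells: "{i \<in> {..<n}. cut_part m1 m2 i = 0} = {..<m1}"
    "{i \<in> {..<n}. cut_part m1 m2 i = 1} = {m1..<m1 + m2}"
    "{i \<in> {..<n}. cut_part m1 m2 i = 2} = {m1 + m2..<n}"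
    using assms(1) by (auto simp: cut_part_def split: if_splits)
  consider "a = 0" | "a = 1" | "a = 2" using assms(2) by linarith
  then show ?thesis
  proof cases
    case 1
    show ?thesis unfolding 1 cells by simp
  next
    case 2
    show ?thesis unfolding 2 cells by simp
  next
    case 3
    show ?thesis unfolding 3 cells using assms(1) by simp
  qed
qed

lemma orbital_endpoints:
  assumes "O_h \<in> orbitals n E" "r \<in> O_h"
  shows "fst r < n" "snd r < n" "fst r \<noteq> snd r"
proof -
  obtain a b \<pi> where \<pi>: "\<pi> permutes {..<n}" and ab: "a < n" "b < n" "a \<noteq> b" and r: "r = (\<pi> a, \<pi> b)"
    using assms unfolding orbitals_def automorphisms_def by auto
  show "fst r < n" "snd r < n" "fst r \<noteq> snd r"
    using permutes_in_image[OF \<pi>] permutes_inj[OF \<pi>] ab by (auto simp: r inj_eq)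
qed

theorem theorem4:
  fixes n m1 m2 m3 :: nat
    and E :: "nat \<Rightarrow> nat \<Rightarrow> bool"
    and s r :: "nat \<times> nat"
    and O_h :: "(nat \<times> nat) set"
  assumes "simple_graph n E"
    and "m1 \<ge> 1" and "m2 \<ge> 1" and "m1 + m2 + m3 = n"
    and "fst s \<in> {0..<m1}" and "snd s \<in> {m1..<m1 + m2}"
    and "O_h \<in> orbitals n E" and "r \<in> O_h"
  defines "\<Gamma> \<equiv> cut_stabilizer m1 m2 m3 s"
  shows "\<exists>\<Phi>. bij_betw \<Phi> (QAP_feasible n s r \<inter> invariant_mats n \<Gamma>) (GPP_feasible n m1 m2 m3 r) \<and>
    (\<forall>Y \<in> QAP_feasible n s r.
       GPP_objective (adj_mat n E) (\<Phi> Y) = QAP_objective (adj_mat n E) (cut_mat m1 m2 m3) Y \<and>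
       group_average n \<Gamma> Y \<in> QAP_feasible n s r \<inter> invariant_mats n \<Gamma> \<and>
       \<Phi> (group_average n \<Gamma> Y) = \<Phi> Y)"
proof -
  note r = orbital_endpoints[OF assms(7,8)]
  have n: "m1 + m2 + m3 = n" by fact
  have s: "fst s < n" "snd s < n" "cut_part m1 m2 (fst s) = 0" "cut_part m1 m2 (snd s) = 1"
    using assms by (auto simp: cut_part_def)
  then have s_ne: "fst s \<noteq> snd s" by auto
  let ?Q = "{(fst s, fst r), (snd s, snd r)}"
  interpret pinned_partition n 3 "cut_part m1 m2" ?Q
    by unfold_locales (use s r s_ne in \<open>auto simp: cut_part_def inj_on_def\<close>)
  \<comment> \<open>Part 0 is the neighbourhood of the second end of the edge, part 1 that of the first, so fixing the
    edge means fixing all three parts.\<close>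
  have \<Gamma>: "\<Gamma> = stabilizer"
  proof (rule equalityI; rule subsetI)
    fix \<sigma> assume "\<sigma> \<in> \<Gamma>"
    then have p: "\<sigma> permutes {..<n}" and fix_s: "\<sigma> (fst s) = fst s" "\<sigma> (snd s) = snd s"
      and adj: "\<And>i k. i < n \<Longrightarrow> k < n \<Longrightarrow>
        (cut_mat m1 m2 m3 $$ (\<sigma> i, \<sigma> k) = 1) = (cut_mat m1 m2 m3 $$ (i, k) = 1)"
      by (auto simp: \<Gamma>_def cut_stabilizer_def automorphisms_def n)
    have "cut_part m1 m2 (\<sigma> i) = cut_part m1 m2 i" if i: "i < n" for i
    proof -
      have \<sigma>i: "\<sigma> i < n" using permutes_in_image[OF p] i by auto
      have "cut_part m1 m2 (\<sigma> i) = 0 \<longleftrightarrow> cut_part m1 m2 i = 0"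
        using adj[OF i s(2)] cut_mat_adjacent[of _ m1 m2 m3 "snd s"] i \<sigma>i s n by (simp add: fix_s)
      moreover have "cut_part m1 m2 (\<sigma> i) = 1 \<longleftrightarrow> cut_part m1 m2 i = 1"
        using adj[OF i s(1)] cut_mat_adjacent[of _ m1 m2 m3 "fst s"] i \<sigma>i s n by (simp add: fix_s)
      ultimately show ?thesis unfolding cut_part_def by (auto split: if_splits)
    qed
    with p fix_s show "\<sigma> \<in> stabilizer" by (simp add: stabilizer_def)
  next
    fix \<sigma> assume \<sigma>: "\<sigma> \<in> stabilizer"
    then have "(cut_mat m1 m2 m3 $$ (\<sigma> i, \<sigma> k) = 1) = (cut_mat m1 m2 m3 $$ (i, k) = 1)" if "i < n" "k < n" for i k
      using that n stabilizer_less[OF \<sigma>] stabilizer_part[OF \<sigma>] by (simp add: cut_mat_adjacent)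
    then show "\<sigma> \<in> \<Gamma>"
      using \<sigma> by (simp add: \<Gamma>_def cut_stabilizer_def automorphisms_def n stabilizer_def)
  qed
  have QAP: "Y \<in> QAP_feasible n s r \<longleftrightarrow> Y \<in> carrier_mat (n * n) (n * n) \<and> fine_moment (entries n Y)" for Y
    unfolding QAP_feasible_iff[OF s(1,2) r(1,2)] fine_moment_def by simp
  have GPP: "(Z, z) \<in> GPP_feasible n m1 m2 m3 r \<longleftrightarrow>
      Z \<in> carrier_mat (3 * n) (3 * n) \<and> z = diag_vec Z \<and> coarse_moment (entries n Z)" for Z z
  proof -
    have "assignment_moment 3 n (\<lambda>a. [m1, m2, m3] ! a) (entries n Z) \<longleftrightarrow>
        assignment_moment 3 n (\<lambda>a. card (cell a)) (entries n Z)"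
      by (rule assignment_moment_cong) (simp_all only: cell_def card_cut_part[OF n])
    then show ?thesis
      unfolding GPP_feasible_iff[OF r(1,2)] coarse_moment_def using s by simp
  qed
  define \<Phi> where "\<Phi> Y = (coarsen Y, diag_vec (coarsen Y))" for Y
  have coarsen: "\<Phi> Y \<in> GPP_feasible n m1 m2 m3 r" if "Y \<in> QAP_feasible n s r" for Y
    using that coarsen_moment by (simp add: \<Phi>_def GPP QAP) (simp add: coarsen_def)
  have average: "group_average n \<Gamma> Y = refine_mat (coarsen Y)" if "Y \<in> QAP_feasible n s r" for Y
    using that group_average_eq_refine_coarsen by (simp add: \<Gamma> QAP)
  have refine: "refine_mat Z \<in> QAP_feasible n s r \<inter> invariant_mats n \<Gamma>"
    "\<Phi> (refine_mat Z) = (Z, z)" if "(Z, z) \<in> GPP_feasible n m1 m2 m3 r" for Z z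
    using that refine_moment refine_invariant coarsen_refine
    by (auto simp: GPP QAP \<Phi>_def \<Gamma> refine_mat_def)
  have "bij_betw \<Phi> (QAP_feasible n s r \<inter> invariant_mats n \<Gamma>) (GPP_feasible n m1 m2 m3 r)"
  proof (rule bij_betw_byWitness[of _ "\<lambda>(Z, z). refine_mat Z"])
    show "\<forall>Y\<in>QAP_feasible n s r \<inter> invariant_mats n \<Gamma>. (case \<Phi> Y of (Z, z) \<Rightarrow> refine_mat Z) = Y"
    proof
      fix Y assume Y: "Y \<in> QAP_feasible n s r \<inter> invariant_mats n \<Gamma>"
      have "stabilizer \<noteq> {}" using id_in_stabilizer by blast
      then have "group_average n \<Gamma> Y = Y"
        using Y finite_stabilizer by (intro group_average_of_invariant) (simp_all add: \<Gamma>)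
      then show "(case \<Phi> Y of (Z, z) \<Rightarrow> refine_mat Z) = Y"
        using average[of Y] Y by (simp add: \<Phi>_def)
    qed
    show "\<forall>P\<in>GPP_feasible n m1 m2 m3 r. \<Phi> (case P of (Z, z) \<Rightarrow> refine_mat Z) = P"
      using refine(2) by auto
    show "\<Phi> ` (QAP_feasible n s r \<inter> invariant_mats n \<Gamma>) \<subseteq> GPP_feasible n m1 m2 m3 r"
      using coarsen by blast
    show "(\<lambda>(Z, z). refine_mat Z) ` GPP_feasible n m1 m2 m3 r \<subseteq> QAP_feasible n s r \<inter> invariant_mats n \<Gamma>"
      using refine(1) by auto
  qed
  moreover have "GPP_objective (adj_mat n E) (\<Phi> Y) = QAP_objective (adj_mat n E) (cut_mat m1 m2 m3) Y"
    if Y: "Y \<in> QAP_feasible n s r" for Y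
  proof -
    have "tr (((E_mat 3 0 1 + E_mat 3 1 0) \<otimes>\<^sub>m adj_mat n E) * coarsen Y) =
        tr ((cut_mat m1 m2 m3 \<otimes>\<^sub>m adj_mat n E) * Y)"
    proof (rule coarsen_objective)
      show "adj_mat n E \<in> carrier_mat n n" by (simp add: adj_mat_def)
      show "cut_mat m1 m2 m3 \<in> carrier_mat n n" using cut_mat_carrier[of m1 m2 m3] n by simp
      show "cut_mat m1 m2 m3 $$ (i, k) = (E_mat 3 0 1 + E_mat 3 1 0) $$ (cut_part m1 m2 i, cut_part m1 m2 k)"
        if "i < n" "k < n" for i k
        using that n by (intro cut_mat_index) simp_all
    qed (use Y QAP in auto)
    then show ?thesis by (simp add: GPP_objective_def QAP_objective_def \<Phi>_def)
  qed
  moreover have "group_average n \<Gamma> Y \<in> QAP_feasible n s r \<inter> invariant_mats n \<Gamma>"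
    "\<Phi> (group_average n \<Gamma> Y) = \<Phi> Y" if Y: "Y \<in> QAP_feasible n s r" for Y
    using refine[OF coarsen[OF Y, unfolded \<Phi>_def]] by (simp_all add: average[OF Y] \<Phi>_def[of Y])
  ultimately show ?thesis by blast
qed

end
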